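(* Let $p$ be a prime and $X=\mathbb Z/(p)\times\mathbb Z/(p)$. Let $(X,r)$ be an indecomposable and irretractable solution of the YBE such that $r((i,j),(k,l))=(\sigma_{(i,j)}(k,l),\sigma^{-1}_{\sigma_{(i,j)}(k,l)}(i,j))$ with $\sigma_{(i,j)}(k,l)=(\sigma_j(k),d_{i,\sigma_j(k)}(l))$ for all $i,j,k,l\in\mathbb Z/(p)$, for some maps $\sigma_j,d_{i,k}:\mathbb Z/(p)\to\mathbb Z/(p)$. Then there exist a nonzero $t\in\mathbb Z/(p)$ and elements $j_0,\dots,j_{p-1}\in\mathbb Z/(p)$ with $j_i=j_{-i}$ and $j_{t^s i}=t^s j_i-(t^s-1)j_0$ for all $i\in\mathbb Z/(p)$, $s\in\mathbb Z$, and $j_i\ne j_k$ for some $i\ne k$, such that $(X,r)$ is isomorphic to the solution $(X,r')$ given by $r'((i,j),(k,l))=(\sigma'_{(i,j)}(k,l),(\sigma'_{\sigma'_{(i,j)}(k,l)})^{-1}(i,j))$ with $\sigma'_{(i,j)}(k,l)=(tk+j,\ t(l-j_{tk+j-i}))$. In particular $(X,r)$ is simple.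
   Context: A solution of the YBE is a pair $(X,r)$, $X$ nonempty, $r:X\times X\to X\times X$, $r(x,y)=(\sigma_x(y),\gamma_y(x))$, with $r^2=\mathrm{id}$, all $\sigma_x,\gamma_x$ bijective, and $r_{12}r_{23}r_{12}=r_{23}r_{12}r_{23}$ on $X^3$. Indecomposable: $\langle\sigma_x\rangle\le \mathrm{Sym}_X$ transitive on $X$. Irretractable: $\sigma_x\ne\sigma_y$ for $x\ne y$. An isomorphism of solutions $f:(X,r)\to(Y,s)$ (with $s(t,z)=(\sigma'_t(z),\gamma'_z(t))$) is a bijection with $f(\sigma_x(y))=\sigma'_{f(x)}(f(y))$ for all $x,y$. $(X,r)$ is simple if $|X|>1$ and every surjective homomorphism of solutions from $(X,r)$ is bijective or has one-point image. *)

theory Defs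
  imports Main "HOL-Computational_Algebra.Primes"
begin

section \<open>Set-theoretic solutions of the Yang-Baxter equation on a carrier set\<close>

definition sig :: "('a \<times> 'a \<Rightarrow> 'a \<times> 'a) \<Rightarrow> 'a \<Rightarrow> 'a \<Rightarrow> 'a" where
  "sig r x y = fst (r (x, y))"

definition gam :: "('a \<times> 'a \<Rightarrow> 'a \<times> 'a) \<Rightarrow> 'a \<Rightarrow> 'a \<Rightarrow> 'a" where
  "gam r y x = snd (r (x, y))"

definition r12 :: "('a \<times> 'a \<Rightarrow> 'a \<times> 'a) \<Rightarrow> 'a \<times> 'a \<times> 'a \<Rightarrow> 'a \<times> 'a \<times> 'a" where
  "r12 r v = (case v of (x, y, z) \<Rightarrow> (fst (r (x, y)), snd (r (x, y)), z))"

definition r23 :: "('a \<times> 'a \<Rightarrow> 'a \<times> 'a) \<Rightarrow> 'a \<times> 'a \<times> 'a \<Rightarrow> 'a \<times> 'a \<times> 'a" where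
  "r23 r v = (case v of (x, y, z) \<Rightarrow> (x, fst (r (y, z)), snd (r (y, z))))"

text \<open>Involutive non-degenerate set-theoretic solution on the carrier X.\<close>
definition is_solution :: "'a set \<Rightarrow> ('a \<times> 'a \<Rightarrow> 'a \<times> 'a) \<Rightarrow> bool" where
  "is_solution X r \<longleftrightarrow>
     X \<noteq> {} \<and>
     (\<forall>x\<in>X. \<forall>y\<in>X. r (x, y) \<in> X \<times> X) \<and>
     (\<forall>x\<in>X. \<forall>y\<in>X. r (r (x, y)) = (x, y)) \<and>
     (\<forall>x\<in>X. bij_betw (sig r x) X X \<and> bij_betw (gam r x) X X) \<and>
     (\<forall>x\<in>X. \<forall>y\<in>X. \<forall>z\<in>X.
        r12 r (r23 r (r12 r (x, y, z))) = r23 r (r12 r (r23 r (x, y, z))))"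

text \<open>Indecomposable: the group generated by all sigma_x acts transitively on X;
  group elements are words in the generators and their inverses.\<close>
definition indecomposable :: "'a set \<Rightarrow> ('a \<times> 'a \<Rightarrow> 'a \<times> 'a) \<Rightarrow> bool" where
  "indecomposable X r \<longleftrightarrow>
     (let R = {(u, sig r z u) | u z. u \<in> X \<and> z \<in> X}
      in \<forall>x\<in>X. \<forall>y\<in>X. (x, y) \<in> (R \<union> R\<inverse>)\<^sup>*)"

definition irretractable :: "'a set \<Rightarrow> ('a \<times> 'a \<Rightarrow> 'a \<times> 'a) \<Rightarrow> bool" where
  "irretractable X r \<longleftrightarrow>
     (\<forall>x\<in>X. \<forall>y\<in>X. x \<noteq> y \<longrightarrow> (\<exists>z\<in>X. sig r x z \<noteq> sig r y z))"

definition is_iso :: "'a set \<Rightarrow> ('a \<times> 'a \<Rightarrow> 'a \<times> 'a) \<Rightarrow> 'b set \<Rightarrow> ('b \<times> 'b \<Rightarrow> 'b \<times> 'b)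
     \<Rightarrow> ('a \<Rightarrow> 'b) \<Rightarrow> bool" where
  "is_iso X r Y s f \<longleftrightarrow> bij_betw f X Y \<and>
     (\<forall>x\<in>X. \<forall>y\<in>X. f (sig r x y) = sig s (f x) (f y))"

text \<open>Homomorphism of solutions: (f x f) o r = s o (f x f) on X x X.\<close>
definition is_hom :: "'a set \<Rightarrow> ('a \<times> 'a \<Rightarrow> 'a \<times> 'a) \<Rightarrow> 'b set \<Rightarrow> ('b \<times> 'b \<Rightarrow> 'b \<times> 'b)
     \<Rightarrow> ('a \<Rightarrow> 'b) \<Rightarrow> bool" where
  "is_hom X r Y s f \<longleftrightarrow> f ` X \<subseteq> Y \<and>
     (\<forall>x\<in>X. \<forall>y\<in>X. s (f x, f y) = (f (fst (r (x, y))), f (snd (r (x, y)))))"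

text \<open>Simplicity, with target solutions ranging over carriers in the type 'b
  (universally quantified at theorem level).\<close>
definition simple_sol :: "'b itself \<Rightarrow> 'a set \<Rightarrow> ('a \<times> 'a \<Rightarrow> 'a \<times> 'a) \<Rightarrow> bool" where
  "simple_sol (T :: 'b itself) X r \<longleftrightarrow>
     (\<exists>x\<in>X. \<exists>y\<in>X. x \<noteq> y) \<and>
     (\<forall>(Y :: 'b set) s f. is_solution Y s \<and> is_hom X r Y s f \<and> f ` X = Y \<longrightarrow>
        inj_on f X \<or> (\<exists>c. f ` X = {c}))"

section \<open>Z/(p) x Z/(p), elements represented by integers in {0..<p}\<close>

definition Zp :: "int \<Rightarrow> int set" where
  "Zp p = {0..<p}"

definition XX :: "int \<Rightarrow> (int \<times> int) set" where
  "XX p = Zp p \<times> Zp p"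

text \<open>The solution r' built from sigma'_{(i,j)}(k,l) = (tk+j, t(l - j_{tk+j-i})).\<close>
definition sigp :: "int \<Rightarrow> int \<Rightarrow> (int \<Rightarrow> int) \<Rightarrow> int \<times> int \<Rightarrow> int \<times> int \<Rightarrow> int \<times> int" where
  "sigp p t jj x y = (case x of (i, j) \<Rightarrow> case y of (k, l) \<Rightarrow>
      ((t * k + j) mod p, (t * (l - jj ((t * k + j - i) mod p))) mod p))"

definition rprime :: "int \<Rightarrow> int \<Rightarrow> (int \<Rightarrow> int) \<Rightarrow> (int \<times> int) \<times> (int \<times> int) \<Rightarrow> (int \<times> int) \<times> (int \<times> int)" where
  "rprime p t jj v = (case v of (x, y) \<Rightarrow>
      (sigp p t jj x y, inv_into (XX p) (sigp p t jj (sigp p t jj x y)) x))"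

end

theory Submission
  imports Defs "HOL-Number_Theory.Cong" "HOL-Combinatorics.Orbits" "HOL-Combinatorics.Cycles"
begin

text \<open>
  Write \<open>S j\<close> and \<open>D i k\<close> for the permutations of \<open>Z = \<int>/(p)\<close> with
  \<open>\<sigma> (i, j) (k, l) = (S j k, D i (S j k) l)\<close>. The Yang--Baxter equation makes
  \<open>S (D a i n) \<circ> inv (S (D 0 0 n))\<close> independent of \<open>n\<close>; call it \<open>c\<close>. For suitable
  \<open>a, i\<close> irretractability gives \<open>c \<noteq> id\<close>, and left multiplication by \<open>c\<close> permutes the
  \<open>p\<close> distinct maps \<open>S j\<close> without fixed points. As \<open>p\<close> is prime, \<open>c\<close> is a \<open>p\<close>-cycle
  and the \<open>S j\<close> form one coset of its powers. Labelling first coordinates along the cycle and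
  second coordinates along the coset turns \<open>S j k\<close> into \<open>t k + j\<close>; the remaining part of the
  Yang--Baxter equation then forces \<open>D i k l = t (l - J (k - i))\<close> with the stated identities
  for \<open>J\<close>.

  To see that the solution is simple, note that the composites \<open>\<sigma> (m', 0) \<circ> inv (\<sigma> (m, 0))\<close> shift the column over \<open>k\<close> by a
  multiple of \<open>J (k - m) - J (k - m')\<close>. If a congruence identifies two points of one column, these
  shifts identify whole columns and then everything. If it only identifies points of two columns at
  distance \<open>h\<close>, then \<open>u x = J x - J (x - 1)\<close> must satisfy \<open>u (x + h) = \<mu> u x\<close>; evenness
  of \<open>J\<close> and \<open>\<mu> ^ p = 1\<close> make \<open>u\<close> constant, which is impossible for odd \<open>p\<close>. For \<open>p = 2\<close>
  also \<open>J\<close> itself is a shift, which is a contradiction as well.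
\<close>

section \<open>Permutations of a set of prime size\<close>

text \<open>A power of \<open>e\<close> with one fixed point is trivial, so all orbits share one
  length \<open>m\<close>, the order of \<open>e\<close>. The orbits partition \<open>Z\<close>,
  hence \<open>m\<close> divides the prime \<open>card Z\<close>, and \<open>e \<noteq> id\<close>
  excludes \<open>m = 1\<close>.\<close>

lemma free_permutation_prime_power_id:
  assumes e: "e permutes Z" and p: "prime (card Z)" and "e \<noteq> id"
    and free: "\<And>x n. x \<in> Z \<Longrightarrow> (e ^^ n) x = x \<Longrightarrow> e ^^ n = id"
  shows "e ^^ card Z = id"
proof -
  have fin: "finite Z" using p by (metis card.infinite not_prime_0)
  have perm: "permutation e" using e fin by (auto simp: permutation_permutes)
  obtain x0 where x0: "x0 \<in> Z" using p by fastforce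
  define m where "m = funpow_dist1 e x0 x0"
  have self: "x \<in> orbit e x" for x by (rule permutation_self_in_orbit[OF perm])
  have em: "e ^^ m = id"
    unfolding m_def by (rule free[OF x0]) (rule funpow_dist1_prop[OF self])
  have m_pos: "0 < m" unfolding m_def by simp
  have card_orbit: "card (orbit e x) = m" if x: "x \<in> Z" for x
  proof -
    define k where "k = funpow_dist1 e x x"
    have "e ^^ k = id" unfolding k_def by (rule free[OF x]) (rule funpow_dist1_prop[OF self])
    then have "\<not> k < m"
      using funpow_dist1_least[of k e x0 x0] by (auto simp: m_def k_def)
    moreover have "\<not> m < k"
      using funpow_dist1_least[of m e x x] em m_pos unfolding k_def by auto
    ultimately have "k = m" by simp
    moreover have "card (orbit e x) = k"
      unfolding orbit_conv_funpow_dist1[OF self] k_def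
      by (subst card_image) (auto intro: inj_on_funpow_dist1 self)
    ultimately show ?thesis by simp
  qed
  let ?R = "{(x, y). x \<in> Z \<and> y \<in> orbit e x}"
  have sub: "orbit e x \<subseteq> Z" if "x \<in> Z" for x by (rule permutes_orbit_subset[OF e that])
  have "equiv Z ?R"
  proof (rule equivI)
    show "refl_on Z ?R" using sub self by (auto simp: refl_on_def)
    show "?R \<subseteq> Z \<times> Z" using sub by auto
    show "sym ?R" using sub self orbit_swap by (fastforce simp: sym_def)
    show "trans ?R" using orbit_trans by (fastforce simp: trans_def)
  qed
  moreover have "m dvd card C" if C: "C \<in> Z // ?R" for C
  proof -
    obtain x where "x \<in> Z" "C = ?R `` {x}" using C unfolding quotient_def by blast
    then have "C = orbit e x" by auto
    with card_orbit[OF \<open>x \<in> Z\<close>] show ?thesis by simp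
  qed
  ultimately have "m dvd card Z" using equiv_imp_dvd_card[OF fin] by blast
  moreover have "m \<noteq> 1" using em \<open>e \<noteq> id\<close> by auto
  ultimately have "m = card Z" using p by (auto simp: prime_nat_iff)
  with em show ?thesis by simp
qed

text \<open>A return time strictly between 0 and the prime would be invertible modulo it, so some
  multiple of it would be congruent to 1 and \<open>g\<close> would fix \<open>x\<close>. Hence the
  first \<open>card Z\<close> iterates of \<open>x\<close> are distinct and fill
  \<open>Z\<close>.\<close>

lemma prime_power_id_orbit_bij:
  assumes g: "g permutes Z" and p: "prime (card Z)" and gp: "g ^^ card Z = id"
    and x: "x \<in> Z" and gx: "g x \<noteq> x"
  shows "bij_betw (\<lambda>n. (g ^^ n) x) {..<card Z} Z"
proof -
  let ?p = "card Z"
  have fin: "finite Z" using p by (metis card.infinite not_prime_0)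
  have no_fix: "(g ^^ n) x \<noteq> x" if n: "0 < n" "n < ?p" for n
  proof
    assume fixed: "(g ^^ n) x = x"
    have "coprime n ?p" using n p
      by (metis coprime_commute nat_dvd_not_less prime_imp_coprime)
    then obtain k where k: "[n * k = 1] (mod ?p)" using cong_solve_coprime_nat by (metis One_nat_def)
    have "(g ^^ (n * k)) x = x"
      using funpow_mod_eq[OF fixed, of "n * k"] by simp
    moreover have "(g ^^ (n * k mod ?p)) x = (g ^^ (n * k)) x"
      by (rule funpow_mod_eq) (simp add: gp)
    moreover have "n * k mod ?p = 1"
      using k prime_gt_1_nat[OF p] by (simp add: cong_def)
    ultimately show False using gx by simp
  qed
  have inj: "inj_on (\<lambda>n. (g ^^ n) x) {..<?p}"
  proof (rule linorder_inj_onI)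
    fix a b assume ab: "a < b" "a \<in> {..<?p}" "b \<in> {..<?p}"
    have "(g ^^ b) x = (g ^^ a) ((g ^^ (b - a)) x)"
      using ab(1) fun_cong[OF funpow_add[of a "b - a" g], of x] by simp
    moreover have "(g ^^ (b - a)) x \<noteq> x" using no_fix[of "b - a"] ab by simp
    ultimately show "(g ^^ a) x \<noteq> (g ^^ b) x"
      using permutes_inj[OF permutes_funpow[OF g]] by (metis injD)
  qed auto
  have "(\<lambda>n. (g ^^ n) x) ` {..<?p} = Z"
  proof (rule card_subset_eq[OF fin])
    show "(\<lambda>n. (g ^^ n) x) ` {..<?p} \<subseteq> Z"
      using permutes_in_image[OF permutes_funpow[OF g]] x by blast
    show "card ((\<lambda>n. (g ^^ n) x) ` {..<?p}) = card Z"
      using card_image[OF inj] by simp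
  qed
  with inj show ?thesis by (simp add: bij_betw_def)
qed

section \<open>Affine coordinates for the maps \<open>S j\<close>\<close>

text \<open>The coordinates are \<open>C n = (c ^^ n) x0\<close> and
  \<open>E m = (e ^^ m) y0\<close>, where \<open>S (e j) = c \<circ> S j\<close>. Since
  \<open>S y0\<close> fixes \<open>x0\<close> and
  \<open>S y0 \<circ> c = (c ^^ t) \<circ> S y0\<close>, the map \<open>S y0\<close> acts as
  multiplication by \<open>t\<close>, and each step of \<open>e\<close> on the label adds 1.\<close>

lemma affine_coordinates:
  fixes S :: "'a \<Rightarrow> 'a \<Rightarrow> 'a" and d :: "'a \<Rightarrow> 'a \<Rightarrow> 'a \<Rightarrow> 'a"
  assumes p: "prime (card Z)"
    and S: "\<And>j. j \<in> Z \<Longrightarrow> S j permutes Z"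
    and d: "\<And>i k. i \<in> Z \<Longrightarrow> k \<in> Z \<Longrightarrow> d i k permutes Z"
    and S_inj: "inj_on S Z"
    and A: "\<And>a i n l. \<lbrakk>a \<in> Z; i \<in> Z; n \<in> Z; l \<in> Z\<rbrakk> \<Longrightarrow> S (d a i n) \<circ> S l = S (d i a l) \<circ> S n"
    and z: "z \<in> Z" and ai: "a \<in> Z" "i \<in> Z" "d a i \<noteq> d z z"
  obtains C E :: "nat \<Rightarrow> 'a" and t :: nat where
    "bij_betw C {..<card Z} Z" "bij_betw E {..<card Z} Z"
    "\<And>n. C (n mod card Z) = C n" "\<And>n. E (n mod card Z) = E n"
    "\<not> card Z dvd t" "\<And>m n. S (E m) (C n) = C (t * n + m)"
proof -
  define \<delta> where "\<delta> = d z z"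
  have \<delta>: "\<delta> permutes Z" unfolding \<delta>_def using d z by blast
  define e where "e = d a i \<circ> inv \<delta>"
  have e: "e permutes Z"
    unfolding e_def using d[OF ai(1,2)] permutes_inv[OF \<delta>] by (rule permutes_compose[rotated])
  note inZ = permutes_in_image[OF e] permutes_in_image[OF \<delta>] permutes_in_image[OF d]
    permutes_in_image[OF permutes_funpow[OF e]]
  have cancel: "f = g" if "f \<circ> S l = g \<circ> S l" "l \<in> Z" for f g :: "'a \<Rightarrow> 'a" and l
    using that permutes_surj[OF S] by (metis surj_fun_eq)
  define c where "c = S (d i a z) \<circ> inv (S (\<delta> z))"
  \<comment> \<open>Both instances of \<open>A\<close> end in \<open>S n\<close>. Eliminating it
    leaves a left factor \<open>c\<close> that does not involve \<open>n\<close>.\<close>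
  have c_\<delta>: "S (d a i n) = c \<circ> S (\<delta> n)" if n: "n \<in> Z" for n
  proof -
    have "S (d a i n) \<circ> S z = S (d i a z) \<circ> S n" using A ai n z by blast
    moreover have "S (\<delta> n) \<circ> S z = S (\<delta> z) \<circ> S n" using A n z unfolding \<delta>_def by blast
    moreover have "inv (S (\<delta> z)) \<circ> S (\<delta> z) = id"
      using permutes_inv_o(2)[OF S] inZ z by blast
    ultimately have "S (d a i n) \<circ> S z = (c \<circ> S (\<delta> n)) \<circ> S z"
      by (simp add: c_def comp_assoc) (metis comp_assoc id_comp)
    then show ?thesis using cancel z by blast
  qed
  have Se: "S (e j) = c \<circ> S j" if j: "j \<in> Z" for j
    using c_\<delta>[of "inv \<delta> j"] j \<delta> by (simp add: e_def permutes_inverses permutes_in_image permutes_inv)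
  have Sen: "S ((e ^^ n) j) = (c ^^ n) \<circ> S j" if j: "j \<in> Z" for n j
    by (induction n) (use j in \<open>auto simp: Se inZ comp_assoc\<close>)
  have c: "c permutes Z"
    unfolding c_def using S permutes_inv[OF S] inZ z ai by (intro permutes_compose) auto
  have e_ne: "e \<noteq> id"
  proof
    assume "e = id"
    then have "d a i \<circ> (inv \<delta> \<circ> \<delta>) = \<delta>" by (simp add: e_def flip: comp_assoc)
    then show False using ai(3) permutes_inv_o(2)[OF \<delta>] by (simp add: \<delta>_def)
  qed
  \<comment> \<open>This and \<open>e_pow\<close> give the freeness needed for \<open>e\<close>: a
    fixed point \<open>x\<close> of \<open>e ^^ n\<close> yields
    \<open>S x = (c ^^ n) \<circ> S x\<close>, so \<open>c ^^ n = id\<close>, and injectivity of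
    \<open>S\<close> carries this back to \<open>e ^^ n\<close>.\<close>
  have c_pow: "c ^^ n = id" if "(e ^^ n) x = x" "x \<in> Z" for n x
    using Sen[OF that(2), of n] that cancel[where f="c ^^ n" and g=id and l=x] by simp
  have e_pow: "e ^^ n = id" if "c ^^ n = id" for n
  proof
    fix x show "(e ^^ n) x = id x"
    proof (cases "x \<in> Z")
      case True
      then have "S ((e ^^ n) x) = S x" using Sen that by simp
      then show ?thesis using inj_onD[OF S_inj] True inZ by auto
    next
      case False
      then show ?thesis using permutes_not_in[OF permutes_funpow[OF e]] by simp
    qed
  qed
  have ep: "e ^^ card Z = id"
    using free_permutation_prime_power_id[OF e p e_ne] c_pow e_pow by blast
  then have cp: "c ^^ card Z = id" using c_pow[of "card Z" z] z by simp
  have c_ne: "c \<noteq> id" using e_pow[of 1] e_ne by auto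
  then obtain x0 where x0: "x0 \<in> Z" "c x0 \<noteq> x0"
    using permutes_not_in[OF c] by fastforce
  have e_fix: "e y \<noteq> y" if "y \<in> Z" for y
    using c_pow[of 1 y] that c_ne by auto
  define C where "C n = (c ^^ n) x0" for n
  have C_bij: "bij_betw C {..<card Z} Z"
    unfolding C_def by (rule prime_power_id_orbit_bij[OF c p cp x0])
  have "S z x0 \<in> Z" using S z x0 permutes_in_image by metis
  then obtain n where n: "n < card Z" "S z x0 = (c ^^ n) x0"
    using C_bij by (auto simp: bij_betw_def C_def)
  \<comment> \<open>\<open>S z x0\<close> lies \<open>n\<close> steps along the cycle of
    \<open>x0\<close>. Advancing the label by \<open>card Z - n\<close> completes a full turn, so
    \<open>S y0\<close> fixes \<open>x0\<close>.\<close>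
  define y0 where "y0 = (e ^^ (card Z - n)) z"
  have y0: "y0 \<in> Z" using inZ z by (simp add: y0_def)
  have Sy0: "S y0 x0 = x0"
  proof -
    have "S y0 x0 = (c ^^ (card Z - n)) ((c ^^ n) x0)"
      using Sen[OF z] n by (simp add: y0_def)
    also have "\<dots> = (c ^^ card Z) x0"
      using n by (metis comp_apply funpow_add le_add_diff_inverse2 less_or_eq_imp_le)
    finally show ?thesis using cp by simp
  qed
  define E where "E n = (e ^^ n) y0" for n
  have E_bij: "bij_betw E {..<card Z} Z"
    unfolding E_def by (rule prime_power_id_orbit_bij[OF e p ep y0 e_fix[OF y0]])
  \<comment> \<open>With \<open>\<delta> l = y0\<close>, the relation \<open>A\<close> at
    \<open>e l\<close> and \<open>l\<close> shows that \<open>S y0 \<circ> c\<close> is again one of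
    the maps \<open>S j\<close>, hence some \<open>(c ^^ t) \<circ> S y0\<close>. This is the origin
    of the multiplier \<open>t\<close>.\<close>
  define l where "l = inv \<delta> y0"
  have l: "l \<in> Z" "\<delta> l = y0"
    using y0 \<delta> by (auto simp: l_def permutes_inverses permutes_in_image permutes_inv)
  have "\<delta> (e l) \<in> Z" using l inZ by simp
  then obtain t where t: "\<delta> (e l) = (e ^^ t) y0"
    using E_bij by (auto simp: bij_betw_def E_def)
  have "S (\<delta> (e l)) \<circ> S l = S (\<delta> l) \<circ> S (e l)"
    using A[OF z z _ l(1), of "e l"] l inZ by (simp add: \<delta>_def)
  also have "\<dots> = (S y0 \<circ> c) \<circ> S l" using Se l by (simp add: comp_assoc)
  finally have "S (\<delta> (e l)) = S y0 \<circ> c" using cancel l by blast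
  then have t_comm: "S y0 \<circ> c = (c ^^ t) \<circ> S y0" using Sen[OF y0] t by simp
  have t_comm_pow: "S y0 ((c ^^ n) x) = (c ^^ (t * n)) (S y0 x)" for n x
  proof (induction n)
    case (Suc n)
    have "S y0 ((c ^^ Suc n) x) = (c ^^ t) (S y0 ((c ^^ n) x))"
      using fun_cong[OF t_comm] by simp
    then show ?case using Suc by (simp add: funpow_add)
  qed simp
  show thesis
  proof (rule that[OF C_bij E_bij])
    show "C (n mod card Z) = C n" for n unfolding C_def by (rule funpow_mod_eq) (simp add: cp)
    show "E (n mod card Z) = E n" for n unfolding E_def by (rule funpow_mod_eq) (simp add: ep)
    show "\<not> card Z dvd t"
    proof
      assume "card Z dvd t"
      then have "(c ^^ t) x = x" for x
        using funpow_mod_eq[where f=c and n="card Z" and x=x and m=t] cp by (simp add: dvd_eq_mod_eq_0)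
      then have "S y0 (c x0) = S y0 x0" using fun_cong[OF t_comm, of x0] by simp
      then show False using permutes_inj[OF S[OF y0]] x0 by (auto dest: injD)
    qed
    show "S (E m) (C n) = C (t * n + m)" for m n
      using Sen[OF y0, of m] t_comm_pow[of n x0] Sy0
      by (simp add: E_def C_def add.commute[of _ m] funpow_add)
  qed
qed

section \<open>The second components modulo p\<close>

lemma prime_int_inverse_mod:
  fixes p t :: int
  assumes "prime p" "\<not> p dvd t"
  obtains t' where "p dvd t * t' - 1"
proof -
  have "coprime t p" using assms by (meson coprime_commute prime_imp_coprime)
  then show thesis using that cong_solve_coprime_int by (metis cong_iff_dvd_diff)
qed

text \<open>\<open>A\<close> makes \<open>d i k\<close> affine with slope \<open>t\<close> and a
  constant term \<open>K i k\<close> symmetric in \<open>i\<close> and \<open>k\<close>.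
  \<open>B\<close> makes \<open>K\<close> constant on the diagonal and then invariant under
  simultaneous translation, so it only depends on \<open>k - i\<close>. \<open>J\<close> is
  \<open>- K 0\<close> divided by \<open>t\<close>, which turns \<open>t * l + K i k\<close> into
  \<open>t * (l - J (k - i))\<close>.\<close>

lemma affine_structure:
  fixes p t :: int and d :: "int \<Rightarrow> int \<Rightarrow> int \<Rightarrow> int"
  assumes p: "prime p" and t: "\<not> p dvd t"
    and per: "\<And>i i' k k' l l'. \<lbrakk>p dvd i - i'; p dvd k - k'; p dvd l - l'\<rbrakk> \<Longrightarrow> p dvd d i k l - d i' k' l'"
    and A: "\<And>a i n l. p dvd (t * l + d a i n) - (t * n + d i a l)"
    and B: "\<And>j b m k q q' l. t * q' + b = t * q + j \<Longrightarrow>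
       p dvd d (t * m + b) (t * q + j) (d k q l) - d (t * k + j) (t * q + j) (d m q' l)"
  obtains J :: "int \<Rightarrow> int" where
    "\<And>x. J x \<in> Zp p" "\<And>x y. p dvd x - y \<Longrightarrow> J x = J y"
    "\<And>x. J (- x) = J x" "\<And>x. p dvd J (t * x) - (t * J x - (t - 1) * J 0)"
    "\<And>i k l. p dvd d i k l - t * (l - J (k - i))"
proof -
  obtain t' where t': "p dvd t * t' - 1" using prime_int_inverse_mod[OF p t] .
  define K where "K i k = d i k 0" for i k
  have K_sym: "p dvd K a i - K i a" for a i using A[of 0 a i 0] by (simp add: K_def)
  have d_K: "p dvd d i k l - (t * l + K i k)" for i k l
    using A[of 0 i k l] K_sym[of k i] unfolding K_def by algebra
  have K_per: "p dvd K i k - K i' k'" if "p dvd i - i'" "p dvd k - k'" for i i' k k'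
    unfolding K_def using that per by simp
  have step: "p dvd (t * K k q + K w w) - (t * K q' q' + K (t * k + j) w)"
    if w: "w = t * q + j" for k q j q' w
  proof -
    \<comment> \<open>Taking \<open>m = q'\<close> and \<open>b = w - t * q'\<close> in
      \<open>B\<close> turns the outer index \<open>t * m + b\<close> into \<open>w\<close>.\<close>
    have "p dvd d w w (K k q) - d (t * k + j) w (K q' q')"
      using B[of q' "t * q + j - t * q'" q j q' k 0] by (simp add: K_def w)
    with d_K[of w w "K k q"] d_K[of "t * k + j" w "K q' q'"] show ?thesis by algebra
  qed
  \<comment> \<open>For \<open>w = t * q\<close> and \<open>k = q\<close> the outer \<open>K\<close>
    terms cancel, and \<open>t\<close> can be divided out.\<close>
  have diag: "p dvd K q q - K 0 0" for q
    using step[of "t * q" q 0 q 0] t' by simp algebra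
  have recur: "p dvd K (t * k + j) (t * q + j) - (t * K k q + (1 - t) * K 0 0)" for k q j
    using step[OF refl, of k q j 0] diag[of "t * q + j"] by algebra
  \<comment> \<open>With \<open>x = (q - k) / t\<close>, both \<open>K k (t * x + k)\<close> and
    \<open>K 0 (t * x)\<close> are given by \<open>recur\<close> with the same right-hand side,
    since that side is independent of the translation \<open>j\<close>.\<close>
  have trans: "p dvd K k q - K 0 (q - k)" for k q
  proof -
    have 1: "p dvd K k (t * (t' * (q - k)) + k) - (t * K 0 (t' * (q - k)) + (1 - t) * K 0 0)"
      using recur[of 0 k "t' * (q - k)"] by simp
    have 2: "p dvd K 0 (t * (t' * (q - k))) - (t * K 0 (t' * (q - k)) + (1 - t) * K 0 0)"
      using recur[of 0 0 "t' * (q - k)"] by simp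
    have e: "p dvd (t * (t' * (q - k)) + k) - q" "p dvd t * (t' * (q - k)) - (q - k)"
      using t' by algebra+
    have 3: "p dvd K k (t * (t' * (q - k)) + k) - K k q"
      "p dvd K 0 (t * (t' * (q - k))) - K 0 (q - k)"
      using K_per e by simp_all
    show ?thesis using 1 2 3 by algebra
  qed
  define J where "J x = (- t' * K 0 x) mod p" for x
  have J_K: "p dvd J x - (- t' * K 0 x)" for x
    unfolding J_def by (metis mod_eq_dvd_iff mod_mod_trivial)
  show thesis
  proof (rule that[of J])
    show "J x \<in> Zp p" for x using prime_gt_0_int[OF p] by (simp add: J_def Zp_def)
    have J_eqI: "J x = J y" if "p dvd K 0 x - K 0 y" for x y
    proof -
      have "p dvd (- t' * K 0 x) - (- t' * K 0 y)" using that by algebra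
      then show ?thesis unfolding J_def by (simp only: mod_eq_dvd_iff)
    qed
    show "J x = J y" if "p dvd x - y" for x y using J_eqI K_per that by simp
    show "J (- x) = J x" for x
      using trans[of x 0] K_sym[of x 0] by (intro J_eqI) (simp, algebra)
    show "p dvd J (t * x) - (t * J x - (t - 1) * J 0)" for x
    proof -
      have "p dvd K 0 (t * x) - (t * K 0 x + (1 - t) * K 0 0)" using recur[of 0 0 x] by simp
      then show ?thesis using J_K[of "t * x"] J_K[of x] J_K[of 0] by algebra
    qed
    show "p dvd d i k l - t * (l - J (k - i))" for i k l
      using d_K[of i k l] trans[of i k] J_K[of "k - i"] t' by algebra
  qed
qed

section \<open>Congruences of the affine solution\<close>

lemma shift_invariant_const:
  fixes p h :: int and G :: "int \<Rightarrow> 'b"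
  assumes p: "prime p" and h: "\<not> p dvd h"
    and per: "\<And>x y. p dvd x - y \<Longrightarrow> G x = G y" and shift: "\<And>x. G (x + h) = G x"
  shows "G x = G y"
proof -
  obtain h' where h': "p dvd h * h' - 1" using prime_int_inverse_mod[OF p h] .
  have iter: "G (x + int n * h) = G x" for n
  proof (induction n)
    case (Suc n)
    have "x + int (Suc n) * h = (x + int n * h) + h" by (simp add: algebra_simps)
    then show ?case using shift[of "x + int n * h"] Suc by (simp only:)
  qed simp
  define n where "n = nat ((h' * (y - x)) mod p)"
  have "int n = (h' * (y - x)) mod p" using prime_gt_0_int[OF p] by (simp add: n_def)
  then have "p dvd int n - h' * (y - x)" by (metis mod_eq_dvd_iff mod_mod_trivial)
  then have "p dvd (x + int n * h) - y" using h' by algebra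
  then show ?thesis using per iter by metis
qed

text \<open>The fibres of \<open>F\<close> model the congruence of a homomorphism:
  \<open>F_sig\<close> is compatibility with \<sigma>, and \<open>F_inv\<close> is left cancellation
  in the target. Thus simplicity becomes a statement about \<open>F\<close> and \<open>J\<close>
  alone: identifying two distinct points identifies all points.\<close>

lemma affine_nontrivial_kernel_total:
  fixes p t :: int and J :: "int \<Rightarrow> int" and F :: "int \<Rightarrow> int \<Rightarrow> 'b"
  assumes p: "prime p" and t: "\<not> p dvd t"
    and J_Zp: "\<And>x. J x \<in> Zp p" and J_per: "\<And>x y. p dvd x - y \<Longrightarrow> J x = J y"
    and J_even: "\<And>x. J (- x) = J x" and J_ne: "J x1 \<noteq> J x2"
    and F_per: "\<And>i i' j j'. p dvd i - i' \<Longrightarrow> p dvd j - j' \<Longrightarrow> F i j = F i' j'"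
    and F_sig: "\<And>i j k l i' j' k' l'. \<lbrakk>F i j = F i' j'; F k l = F k' l'\<rbrakk> \<Longrightarrow>
      F (t * k + j) (t * (l - J (t * k + j - i))) = F (t * k' + j') (t * (l' - J (t * k' + j' - i')))"
    and F_inv: "\<And>i j k l k' l'.
      F (t * k + j) (t * (l - J (t * k + j - i))) = F (t * k' + j) (t * (l' - J (t * k' + j - i)))
      \<Longrightarrow> F k l = F k' l'"
    and pair: "F i0 j0 = F i1 j1" "\<not> (p dvd i0 - i1 \<and> p dvd j0 - j1)"
  shows "F a b = F a' b'"
proof -
  have two_prime: "prime (2 :: int)" by simp
  obtain t' where t': "p dvd t * t' - 1" using prime_int_inverse_mod[OF p t] .
  have J_eqI: "J x = J y" if "p dvd J x - J y" for x y
    using that J_Zp[of x] J_Zp[of y] unfolding Zp_def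
    by (metis atLeastLessThan_iff mod_eq_dvd_iff mod_pos_pos_trivial)
  \<comment> \<open>\<open>shift w\<close> says that the column translation
    \<open>(k, l) \<mapsto> (k, l + w k)\<close> respects the fibres of \<open>F\<close>. Such
    \<open>w\<close> are closed under integer linear combinations.\<close>
  define shift where "shift w \<longleftrightarrow>
    (\<forall>k l k' l'. F k l = F k' l' \<longrightarrow> F k (l + w k) = F k' (l' + w k'))" for w :: "int \<Rightarrow> int"
  have shift_add: "shift (\<lambda>k. v k + w k)" if "shift v" "shift w" for v w
    using that unfolding shift_def by (metis add.assoc)
  have shift_mult: "shift (\<lambda>k. c * w k)" if w: "shift w" for c w
  proof -
    have n: "shift (\<lambda>k. int n * w k)" for n
    proof (induction n)
      case 0 show ?case by (simp add: shift_def)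
    next
      case (Suc n)
      have "(\<lambda>k. int (Suc n) * w k) = (\<lambda>k. int n * w k + w k)" by (auto simp: algebra_simps)
      then show ?case using shift_add[OF Suc w] by simp
    qed
    define n where "n = nat (c mod p)"
    have "int n = c mod p" using prime_gt_0_int[OF p] by (simp add: n_def)
    then have "p dvd int n - c" by (metis mod_eq_dvd_iff mod_mod_trivial)
    then have "p dvd (l + int n * w k) - (l + c * w k)" for l k by algebra
    then have eq: "F k (l + int n * w k) = F k (l + c * w k)" for l k by (intro F_per) simp_all
    show ?thesis using n[of n] unfolding shift_def eq .
  qed
  have shift_J: "shift (\<lambda>k. c * (J (k - m) - J (k - m')))" for c m m'
  proof -
    have "shift (\<lambda>k. t * (J (k - m) - J (k - m')))"
      unfolding shift_def
    proof (intro allI impI)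
      fix k l k' l' assume eq: "F k l = F k' l'"
      \<comment> \<open>\<open>(t' * k, \<nu> k l)\<close> is the preimage of \<open>(k, l)\<close>
        under the action of \<open>(m, 0)\<close>. Applying \<open>(m', 0)\<close> to it returns to
        column \<open>k\<close>, translated by \<open>t * (J (k - m) - J (k - m'))\<close>; the
        factor \<open>t\<close> is scaled away afterwards.\<close>
      define \<nu> where "\<nu> k l = t' * l + J (k - m)" for k l
      have tk: "p dvd t * (t' * k) + 0 - k" for k using t' by algebra
      have Jk: "J (t * (t' * k) + 0 - m) = J (k - m)" for k m
        using tk[of k] by (intro J_per) simp
      have 1: "F (t * (t' * k) + 0) (t * (\<nu> k l - J (t * (t' * k) + 0 - m))) = F k l" for k l
      proof (rule F_per[OF tk])
        show "p dvd t * (\<nu> k l - J (t * (t' * k) + 0 - m)) - l"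
          unfolding Jk \<nu>_def using t' by algebra
      qed
      have 2: "F (t * (t' * k) + 0) (t * (\<nu> k l - J (t * (t' * k) + 0 - m')))
          = F k (l + t * (J (k - m) - J (k - m')))" for k l
      proof (rule F_per[OF tk])
        show "p dvd t * (\<nu> k l - J (t * (t' * k) + 0 - m')) - (l + t * (J (k - m) - J (k - m')))"
          unfolding Jk \<nu>_def using t' by algebra
      qed
      have "F (t' * k) (\<nu> k l) = F (t' * k') (\<nu> k' l')"
        by (rule F_inv[of _ 0 _ m]) (simp only: 1 eq)
      from F_sig[OF refl this, of 0 m']
      show "F k (l + t * (J (k - m) - J (k - m'))) = F k' (l' + t * (J (k' - m) - J (k' - m')))"
        by (simp only: 2)
    qed
    from shift_mult[OF this, of "c * t'"]
    have sh: "shift (\<lambda>k. c * t' * (t * (J (k - m) - J (k - m'))))" .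
    have eq: "F k (l + c * t' * (t * (J (k - m) - J (k - m'))))
      = F k (l + c * (J (k - m) - J (k - m')))" for k l
    proof (rule F_per)
      show "p dvd (l + c * t' * (t * (J (k - m) - J (k - m')))) - (l + c * (J (k - m) - J (k - m')))"
        using t' by algebra
    qed simp
    show ?thesis using sh unfolding shift_def eq .
  qed

  have vertical: "F a b = F a' b'" if eq: "F x y = F x y'" and ne: "\<not> p dvd y - y'" for x y y'
  proof -
    have ne': "\<not> p dvd y' - y" using ne by (simp add: dvd_diff_commute)
    have "\<not> p dvd J x1 - J x2" using J_ne J_eqI by blast
    then obtain g where g: "p dvd (J x1 - J x2) * g - 1" using prime_int_inverse_mod[OF p] by blast
    have sc: "F x (y + c) = F x (y' + c)" for c
    proof -
      \<comment> \<open>At column \<open>x\<close> the chosen centres give the amount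
        \<open>c * g * (J x1 - J x2)\<close>, which is \<open>c\<close> modulo \<open>p\<close>. So
        the identified pair can be moved anywhere in its column.\<close>
      let ?w = "\<lambda>k. (c * g) * (J (k - (x - x1)) - J (k - (x - x2)))"
      have "F x (y + ?w x) = F x (y' + ?w x)"
        using shift_J[of "c * g" "x - x1" "x - x2"] eq unfolding shift_def by blast
      moreover have "p dvd ?w x - c" using g by simp algebra
      then have "F x (z + ?w x) = F x (z + c)" for z by (intro F_per) simp_all
      ultimately show ?thesis by simp
    qed
    have shift_col: "F x (z + (y' - y)) = F x z" for z
    proof -
      have "y + (z - y) = z" "y' + (z - y) = z + (y' - y)" by simp_all
      then show ?thesis using sc[of "z - y"] by (simp only:)
    qed
    have col: "F x l = F x l'" for l l'
      by (rule shift_invariant_const[where G="F x", OF p ne' F_per shift_col]) simp_all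
    have cols: "F z l = F z l'" for z l l'
    proof -
      \<comment> \<open>The element \<open>(0, z - t * x)\<close> carries the collapsed column
        \<open>x\<close> onto column \<open>z\<close>.\<close>
      have "F (t * x + (z - t * x)) (t * (t' * l + J z - J (t * x + (z - t * x) - 0)))
         = F (t * x + (z - t * x)) (t * (t' * l' + J z - J (t * x + (z - t * x) - 0)))"
        by (rule F_sig[OF refl col])
      then have "F z (t * (t' * l)) = F z (t * (t' * l'))" by simp
      moreover have "p dvd t * (t' * l) - l" for l using t' by algebra
      then have "F z (t * (t' * l)) = F z l" for l by (intro F_per) simp_all
      ultimately show ?thesis by simp
    qed
    \<comment> \<open>The equivalent points \<open>(x, y)\<close> and \<open>(x, y')\<close> now
      serve as acting elements; they send one column to columns at distance
      \<open>y' - y\<close>.\<close>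
    have shift_row: "F (z + (y' - y)) 0 = F z 0" for z
    proof -
      have "F (t * (t' * (z - y)) + y) 0 = F (t * (t' * (z - y)) + y') 0"
        using F_sig[OF eq refl, of "t' * (z - y)" 0] cols by metis
      moreover have "p dvd (t * (t' * (z - y)) + y) - z" using t' by algebra
      then have "F (t * (t' * (z - y)) + y) 0 = F z 0" by (intro F_per) simp_all
      moreover have "p dvd (t * (t' * (z - y)) + y') - (z + (y' - y))" using t' by algebra
      then have "F (t * (t' * (z - y)) + y') 0 = F (z + (y' - y)) 0" by (intro F_per) simp_all
      ultimately show ?thesis by simp
    qed
    have "F z 0 = F z' 0" for z z'
      by (rule shift_invariant_const[where G="\<lambda>z. F z 0", OF p ne' F_per shift_row]) simp_all
    then show ?thesis using cols by metis
  qed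

  show ?thesis
  proof (rule ccontr)
    assume "F a b \<noteq> F a' b'"
    then have novert: "p dvd y - y'" if "F x y = F x y'" for x y y' using vertical that by blast
    have i01: "\<not> p dvd i1 - i0"
    proof
      assume "p dvd i1 - i0"
      then have i: "p dvd i0 - i1" by (simp add: dvd_diff_commute)
      then have "F i0 j0 = F i0 j1" using F_per[of i0 i1 j1 j1] pair(1) by simp
      then show False using novert pair(2) i by blast
    qed
    define h where "h = i1 - i0"
    \<comment> \<open>If \<open>w\<close> does not move \<open>(i0, j0)\<close>, then
      \<open>(i1, j1 + w i1)\<close> is still identified with \<open>(i1, j1)\<close>, and distinct
      points of one column are never identified.\<close>
    have shift_zero: "p dvd w i1" if w: "shift w" and w0: "p dvd w i0" for w
    proof -
      have "F i0 (j0 + w i0) = F i1 (j1 + w i1)" using w pair(1) unfolding shift_def by blast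
      moreover have "F i0 (j0 + w i0) = F i0 j0" using w0 by (intro F_per) simp_all
      ultimately have "F i1 (j1 + w i1) = F i1 j1" using pair(1) by simp
      from novert[OF this] show ?thesis by simp
    qed
    define u where "u x = J x - J (x - 1)" for x
    have shift_u: "shift (\<lambda>k. c * u (k - m))" for c m
      using shift_J[of c m "m + 1"] by (simp add: u_def algebra_simps)
    have u_per: "u x = u y" if "p dvd x - y" for x y
      unfolding u_def using J_per[OF that] J_per[of "x - 1" "y - 1"] that by simp
    have u_odd: "u (1 - x) = - u x" for x
      unfolding u_def using J_even[of "x - 1"] J_even[of x] by simp
    have ratio: "p dvd u x * u (y + h) - u y * u (x + h)" for x y
    proof -
      \<comment> \<open>The coefficients make this combination of shifts vanish at
        \<open>i0\<close>; its value at \<open>i1\<close> is the claimed expression.\<close>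
      let ?w = "\<lambda>k. u x * u (k - (i0 - y)) + (- u y) * u (k - (i0 - x))"
      have "shift ?w" by (rule shift_add[OF shift_u shift_u])
      moreover have "p dvd ?w i0" by simp
      ultimately have "p dvd ?w i1" by (rule shift_zero)
      then show ?thesis by (simp add: h_def algebra_simps)
    qed
    obtain y0 where y0: "\<not> p dvd u y0"
    proof (rule ccontr)
      assume "\<not> thesis"
      then have "p dvd u (x + 1)" for x using that by blast
      then have "J (x + 1) = J x" for x using J_eqI[of "x + 1" x] by (simp add: u_def)
      moreover have "\<not> p dvd 1" using p not_prime_unit by blast
      ultimately show False
        using shift_invariant_const[where G=J, OF p _ J_per, of 1] J_ne by blast
    qed
    obtain v where v: "p dvd u y0 * v - 1" using prime_int_inverse_mod[OF p y0] .
    define \<mu> where "\<mu> = u (y0 + h) * v"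
    have u_h: "p dvd u (x + h) - \<mu> * u x" for x
      using ratio[of x y0] v unfolding \<mu>_def by algebra
    have "p dvd \<mu>\<^sup>2 - 1"
    proof -
      \<comment> \<open>The reflection \<open>x \<mapsto> 1 - x\<close> negates \<open>u\<close> and
        reverses the step \<open>h\<close>, so \<mu> is its own inverse. Going \<open>p\<close>
        steps around gives \<open>\<mu> ^ p = 1\<close> as well, which rules out -1 for odd
        \<open>p\<close>.\<close>
      have "p dvd u (1 - y0) - \<mu> * u (1 - (y0 + h))" using u_h[of "1 - (y0 + h)"] by simp
      then have "p dvd - u y0 + \<mu> * u (y0 + h)" by (simp add: u_odd)
      then show ?thesis using u_h[of y0] v by algebra
    qed
    moreover have \<mu>_pow: "p dvd \<mu> ^ nat p - 1"
    proof -
      have iter: "p dvd u (y0 + int n * h) - \<mu> ^ n * u y0" for n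
      proof (induction n)
        case (Suc n)
        have "y0 + int (Suc n) * h = (y0 + int n * h) + h" by (simp add: algebra_simps)
        then have "p dvd u (y0 + int (Suc n) * h) - \<mu> * u (y0 + int n * h)"
          using u_h[of "y0 + int n * h"] by (simp only:)
        moreover have "p dvd \<mu> * (u (y0 + int n * h) - \<mu> ^ n * u y0)" using Suc by simp
        ultimately have "p dvd (u (y0 + int (Suc n) * h) - \<mu> * u (y0 + int n * h))
          + \<mu> * (u (y0 + int n * h) - \<mu> ^ n * u y0)" by (rule dvd_add)
        then show ?case by (simp add: algebra_simps)
      qed simp
      have "u (y0 + int (nat p) * h) = u y0"
        using prime_gt_0_int[OF p] by (intro u_per) simp
      then have "p dvd u y0 - \<mu> ^ nat p * u y0" using iter[of "nat p"] by simp
      moreover have "p dvd c - 1" if "p dvd u y0 - c * u y0" for c using v that by algebra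
      ultimately show ?thesis by blast
    qed
    ultimately have \<mu>1: "p dvd \<mu> - 1"
    proof -
      assume "p dvd \<mu>\<^sup>2 - 1"
      then have "p dvd (\<mu> - 1) * (\<mu> + 1)" by (simp add: power2_eq_square algebra_simps)
      then consider "p dvd \<mu> - 1" | "p dvd \<mu> + 1" using p prime_dvd_mult_iff by blast
      then show ?thesis
      proof cases
        case 2
        show ?thesis
        proof (cases "p = 2")
          case True
          then show ?thesis using 2 by presburger
        next
          case False
          then have "odd p" using p by (metis primes_dvd_imp_eq two_prime)
          then have "odd (nat p)" using prime_gt_0_int[OF p] by (simp add: even_nat_iff)
          then have "(- 1 :: int) ^ nat p = - 1" by simp
          moreover have "[\<mu> ^ nat p = (- 1) ^ nat p] (mod p)"
            by (rule cong_pow) (use 2 in \<open>simp add: cong_iff_dvd_diff\<close>)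
          ultimately have "p dvd \<mu> ^ nat p + 1" by (simp add: cong_iff_dvd_diff)
          with \<mu>_pow have "p dvd (\<mu> ^ nat p + 1) - (\<mu> ^ nat p - 1)" using dvd_diff by blast
          then have "p dvd 2" by simp
          then show ?thesis using False p by (metis primes_dvd_imp_eq two_prime)
        qed
      qed
    qed
    have u_const: "p dvd u x - u y" for x y
    proof -
      have "p dvd u (x + h) - u x" for x using u_h[of x] \<mu>1 by algebra
      then have "u (x + h) mod p = u x mod p" for x by (simp add: mod_eq_dvd_iff)
      then have "u (x + (i1 - i0)) mod p = u x mod p" for x by (simp only: h_def)
      then have "u x mod p = u y mod p"
      proof (rule shift_invariant_const[where G="\<lambda>x. u x mod p", OF p i01, rotated])
        show "u x mod p = u y mod p" if "p dvd x - y" for x y using u_per[OF that] by (simp only:)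
      qed
      then show ?thesis by (simp add: mod_eq_dvd_iff)
    qed
    \<comment> \<open>A constant \<open>u\<close> with \<open>u (1 - x) = - u x\<close> forces
      \<open>2 * u = 0\<close>, and \<open>u\<close> is nonzero.\<close>
    have "p dvd 2 * u y0" using u_const[of "1 - y0" y0] u_odd[of y0] by simp
    then have "p dvd 2" using y0 p prime_dvd_mult_iff by blast
    then have p2: "p = 2" using p primes_dvd_imp_eq two_prime by blast
    \<comment> \<open>For \<open>p = 2\<close> the nonzero \<open>t\<close> is 1, so
      \<open>(0, 0)\<close> maps each column to itself, translating it by
      \<open>- J k\<close>.\<close>
    have shift_J0: "shift (\<lambda>k. - J k)"
      unfolding shift_def
    proof (intro allI impI)
      fix k l k' l' assume eq: "F k l = F k' l'"
      have t1: "p dvd t - 1" using t p2 by presburger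
      have tk: "p dvd t * k + 0 - k" for k using t1 by algebra
      have tl: "F (t * k + 0) (t * (l - J (t * k + 0 - 0))) = F k (l + - J k)" for k l
      proof (rule F_per[OF tk])
        have "J (t * k + 0 - 0) = J k" using tk[of k] by (intro J_per) simp
        moreover have "p dvd t * (l - J k) - (l + - J k)" using t1 by algebra
        ultimately show "p dvd t * (l - J (t * k + 0 - 0)) - (l + - J k)" by (simp only:)
      qed
      show "F k (l + - J k) = F k' (l' + - J k')"
        using F_sig[OF refl eq, of 0 0] by (simp only: tl)
    qed
    \<comment> \<open>As \<open>u\<close> is constantly 1 modulo 2, this shift vanishes at
      \<open>i0\<close>. Vanishing at \<open>i1\<close> too gives
      \<open>J i1 = J i0 = J (i1 - 1)\<close>, against \<open>u i1 = 1\<close>.\<close>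
    let ?w = "\<lambda>k. - J k + J i0 * u (k - 0)"
    have u1: "p dvd u k - 1" for k using u_const[of k y0] y0 p2 by presburger
    have "shift ?w" by (rule shift_add[OF shift_J0 shift_u])
    moreover have "p dvd ?w i0" using u1[of i0] unfolding diff_0_right by algebra
    ultimately have "p dvd ?w i1" by (rule shift_zero)
    then have "p dvd J i1 - J i0" using u1[of i1] unfolding diff_0_right by algebra
    moreover have "J (i1 - 1) = J i0" using i01 p2 by (intro J_per) presburger
    ultimately have "p dvd u i1" by (simp add: u_def)
    then show False using u1[of i1] by (auto simp: p2)
  qed
qed

section \<open>Consequences of the Yang-Baxter equation\<close>

lemma solution_transfer:
  assumes sol: "is_solution X r" and f: "bij_betw f X Y"
    and hom: "\<And>x y. x \<in> X \<Longrightarrow> y \<in> X \<Longrightarrow> s (f x, f y) = (f (fst (r (x, y))), f (snd (r (x, y))))"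
  shows "is_solution Y s"
proof -
  have Y: "Y = f ` X" using f by (simp add: bij_betw_def)
  have closed: "fst (r (x, y)) \<in> X" "snd (r (x, y)) \<in> X" if "x \<in> X" "y \<in> X" for x y
    using sol that by (auto simp: is_solution_def mem_Times_iff)
  have invol: "r (fst (r (x, y)), snd (r (x, y))) = (x, y)" if "x \<in> X" "y \<in> X" for x y
    using sol that by (simp add: is_solution_def)
  have bij_conj: "bij_betw h' Y Y" if h: "bij_betw h X X" and eq: "\<And>x. x \<in> X \<Longrightarrow> h' (f x) = f (h x)"
    for h h'
  proof -
    have "bij_betw (f \<circ> h) X Y" using h f by (rule bij_betw_trans)
    then have "bij_betw (h' \<circ> f) X Y" using eq by (simp cong: bij_betw_cong)
    then show ?thesis using bij_betw_comp_iff[OF f, of h'] by simp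
  qed
  show ?thesis
    unfolding is_solution_def
  proof (intro conjI ballI)
    show "Y \<noteq> {}" using sol by (auto simp: Y is_solution_def)
    fix x' assume "x' \<in> Y"
    then obtain x where x: "x \<in> X" "x' = f x" by (auto simp: Y)
    have "bij_betw (sig r x) X X" "bij_betw (gam r x) X X" using sol x by (auto simp: is_solution_def)
    moreover have "sig s x' (f u) = f (sig r x u)" "gam s x' (f u) = f (gam r x u)" if "u \<in> X" for u
      using x that hom by (simp_all add: sig_def gam_def)
    ultimately show "bij_betw (sig s x') Y Y" "bij_betw (gam s x') Y Y" using bij_conj by blast+
    fix y' assume "y' \<in> Y"
    then obtain y where y: "y \<in> X" "y' = f y" by (auto simp: Y)
    show "s (x', y') \<in> Y \<times> Y" using x y hom closed by (simp add: Y)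
    show "s (s (x', y')) = (x', y')" using x y hom closed invol by simp
    fix z' assume "z' \<in> Y"
    then obtain z where z: "z \<in> X" "z' = f z" by (auto simp: Y)
    have "r12 r (r23 r (r12 r (x, y, z))) = r23 r (r12 r (r23 r (x, y, z)))"
      using sol x y z by (simp add: is_solution_def)
    then show "r12 s (r23 s (r12 s (x', y', z'))) = r23 s (r12 s (r23 s (x', y', z')))"
      using x y z hom closed by (simp add: r12_def r23_def split_beta prod_eq_iff)
  qed
qed

lemma solution_sig_comp:
  assumes "is_solution X r" "x \<in> X" "y \<in> X" "z \<in> X"
  shows "sig r x (sig r y z) = sig r (sig r x y) (sig r (snd (r (x, y))) z)"
proof -
  have "r12 r (r23 r (r12 r (x, y, z))) = r23 r (r12 r (r23 r (x, y, z)))"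
    using assms by (simp add: is_solution_def)
  then show ?thesis by (simp add: r12_def r23_def sig_def split_beta)
qed

lemma solution_sig_gam:
  assumes "is_solution X r" "x \<in> X" "y \<in> X"
  shows "sig r (sig r x y) (snd (r (x, y))) = x"
  using assms by (simp add: is_solution_def sig_def)

lemma solution_closed:
  assumes "is_solution X r" "x \<in> X" "y \<in> X"
  shows "sig r x y \<in> X" "snd (r (x, y)) \<in> X"
  using assms by (auto simp: is_solution_def sig_def mem_Times_iff)

text \<open>The last two conclusions are the two coordinates of
  \<open>\<sigma> x \<circ> \<sigma> y = \<sigma> (\<sigma> x y) \<circ> \<sigma> (\<gamma> y x)\<close>, reparametrised so that no inverse occurs.\<close>

lemma fibred_solution:
  assumes sol: "is_solution (Z \<times> Z) r" and fin: "finite Z" and irr: "irretractable (Z \<times> Z) r"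
    and sj: "\<And>j k. j \<in> Z \<Longrightarrow> k \<in> Z \<Longrightarrow> sj j k \<in> Z"
    and d: "\<And>i k l. i \<in> Z \<Longrightarrow> k \<in> Z \<Longrightarrow> l \<in> Z \<Longrightarrow> d i k l \<in> Z"
    and form: "\<And>i j k l. \<lbrakk>i \<in> Z; j \<in> Z; k \<in> Z; l \<in> Z\<rbrakk> \<Longrightarrow>
      sig r (i, j) (k, l) = (sj j k, d i (sj j k) l)"
  obtains S D where
    "\<And>j. j \<in> Z \<Longrightarrow> S j permutes Z" "\<And>i k. i \<in> Z \<Longrightarrow> k \<in> Z \<Longrightarrow> D i k permutes Z"
    "\<And>i j k l. \<lbrakk>i \<in> Z; j \<in> Z; k \<in> Z; l \<in> Z\<rbrakk> \<Longrightarrow> sig r (i, j) (k, l) = (S j k, D i (S j k) l)"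
    "inj_on S Z"
    "\<And>a i n l. \<lbrakk>a \<in> Z; i \<in> Z; n \<in> Z; l \<in> Z\<rbrakk> \<Longrightarrow> S (D a i n) \<circ> S l = S (D i a l) \<circ> S n"
    "\<And>j b m k q q' l. \<lbrakk>j \<in> Z; b \<in> Z; m \<in> Z; k \<in> Z; q \<in> Z; q' \<in> Z; l \<in> Z; S b q' = S j q\<rbrakk> \<Longrightarrow>
       D (S b m) (S j q) (D k q l) = D (S j k) (S j q) (D m q' l)"
proof -
  \<comment> \<open>Both families are the identity outside \<open>Z\<close>, as
    \<open>permutes\<close> demands; this also lets the relation on \<open>S\<close> hold as an
    equation of functions.\<close>
  define S where "S j k = (if k \<in> Z then sj j k else k)" for j k
  define D where "D i k l = (if l \<in> Z then d i k l else l)" for i k l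
  obtain z where z: "z \<in> Z" using sol by (auto simp: is_solution_def)
  have bij: "bij_betw (sig r x) (Z \<times> Z) (Z \<times> Z)" if "x \<in> Z \<times> Z" for x
    using sol that unfolding is_solution_def by blast
  have permI: "g permutes Z" if "g ` Z = Z" "\<And>x. x \<notin> Z \<Longrightarrow> g x = x" for g
    using that fin by (intro bij_imp_permutes) (auto simp: bij_betw_def intro: eq_card_imp_inj_on)
  have S: "S j permutes Z" if j: "j \<in> Z" for j
  proof (rule permI)
    show "S j ` Z = Z"
    proof
      show "S j ` Z \<subseteq> Z" using sj j by (auto simp: S_def)
      show "Z \<subseteq> S j ` Z"
      proof
        fix k' assume "k' \<in> Z"
        then have "(k', z) \<in> sig r (z, j) ` (Z \<times> Z)" using bij[of "(z, j)"] j z by (simp add: bij_betw_def)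
        then obtain k l where "k \<in> Z" "l \<in> Z" "(k', z) = sig r (z, j) (k, l)" by auto
        then show "k' \<in> S j ` Z" using form[of z j k l] z j by (auto simp: S_def)
      qed
    qed
  qed (simp add: S_def)
  have D: "D i k permutes Z" if i: "i \<in> Z" and k: "k \<in> Z" for i k
  proof (rule permI)
    show "D i k ` Z = Z"
    proof
      show "D i k ` Z \<subseteq> Z" using d i k by (auto simp: D_def)
      show "Z \<subseteq> D i k ` Z"
      proof
        fix l' assume "l' \<in> Z"
        then have "(k, l') \<in> sig r (i, z) ` (Z \<times> Z)" using bij[of "(i, z)"] i k z by (simp add: bij_betw_def)
        then obtain k0 l where kl: "k0 \<in> Z" "l \<in> Z" "(k, l') = sig r (i, z) (k0, l)" by auto
        then have "l' = D i k l" using form[of i z k0 l] z i by (auto simp: D_def)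
        then show "l' \<in> D i k ` Z" using kl by blast
      qed
    qed
  qed (simp add: D_def)
  note SZ = permutes_in_image[OF S] and DZ = permutes_in_image[OF D]
  have S_ex: "\<exists>k\<in>Z. S j k = a" if "j \<in> Z" "a \<in> Z" for j a
    using permutes_image[OF S[OF that(1)]] that by (metis image_iff)
  have D_ex: "\<exists>l\<in>Z. D i k l = a" if "i \<in> Z" "k \<in> Z" "a \<in> Z" for i k a
    using permutes_image[OF D[OF that(1,2)]] that by (metis image_iff)
  have S_cancel: "k = k'" if "S j k = S j k'" "j \<in> Z" for j k k'
    using permutes_inj[OF S[OF that(2)]] that by (auto dest: injD)
  have D_cancel: "l = l'" if "D i k l = D i k l'" "i \<in> Z" "k \<in> Z" for i k l l'
    using permutes_inj[OF D[OF that(2,3)]] that by (auto dest: injD)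
  have sigSD: "sig r (i, j) (k, l) = (S j k, D i (S j k) l)"
    if "i \<in> Z" "j \<in> Z" "k \<in> Z" "l \<in> Z" for i j k l
    using form that by (simp add: S_def D_def)
  \<comment> \<open>Here \<open>(a, b)\<close> and \<open>(m, n)\<close> are the two components of
    \<open>r ((i, j), (k, l))\<close>. The condition \<open>S b m = i\<close> determines
    \<open>m\<close>, and \<open>D a i n = j\<close> determines \<open>n\<close>, so inverses are
    avoided.\<close>
  have ybe: "\<exists>n\<in>Z. D a i n = j \<and>
      (\<forall>w\<in>Z. \<forall>v\<in>Z. S j (S l w) = S b (S n w) \<and>
        D i (S j (S l w)) (D k (S l w) v) = D a (S j (S l w)) (D m (S n w) v))"
    if in_Z: "i \<in> Z" "j \<in> Z" "k \<in> Z" "l \<in> Z" "m \<in> Z" and a: "a = S j k" and b: "b = D i a l"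
      and i: "S b m = i" for i j k l m a b
  proof -
    have ab: "a \<in> Z" "b \<in> Z" using a b in_Z SZ DZ by auto
    have xy: "sig r (i, j) (k, l) = (a, b)" using sigSD in_Z a b by simp
    obtain m' n where u: "snd (r ((i, j), (k, l))) = (m', n)" by fastforce
    have mn: "m' \<in> Z" "n \<in> Z"
      using solution_closed(2)[OF sol, of "(i, j)" "(k, l)"] in_Z u by auto
    have "sig r (a, b) (m', n) = (i, j)"
      using solution_sig_gam[OF sol, of "(i, j)" "(k, l)"] in_Z u xy by simp
    then have "S b m' = i" "D a i n = j" using sigSD ab mn by auto
    then have "m' = m" using S_cancel i ab by blast
    have "S j (S l w) = S b (S n w) \<and>
        D i (S j (S l w)) (D k (S l w) v) = D a (S j (S l w)) (D m (S n w) v)"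
      if "w \<in> Z" "v \<in> Z" for w v
      using solution_sig_comp[OF sol, of "(i, j)" "(k, l)" "(w, v)"] in_Z ab mn that
        \<open>m' = m\<close> u xy SZ DZ by (auto simp: sigSD)
    then show ?thesis using mn \<open>D a i n = j\<close> by blast
  qed
  show thesis
  proof (rule that[of S D])
    show "S j permutes Z" if "j \<in> Z" for j by (rule S[OF that])
    show "D i k permutes Z" if "i \<in> Z" "k \<in> Z" for i k by (rule D[OF that])
    show "sig r (i, j) (k, l) = (S j k, D i (S j k) l)"
      if "i \<in> Z" "j \<in> Z" "k \<in> Z" "l \<in> Z" for i j k l by (rule sigSD[OF that])
    show "inj_on S Z"
    proof (rule inj_onI, rule ccontr)
      fix j l assume jl: "j \<in> Z" "l \<in> Z" "S j = S l" "j \<noteq> l"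
      then obtain y where "y \<in> Z \<times> Z" "sig r (z, j) y \<noteq> sig r (z, l) y"
        using irr z unfolding irretractable_def by blast
      then show False using jl z by (auto simp: sigSD)
    qed
    show "S (D a i n) \<circ> S l = S (D i a l) \<circ> S n"
      if in_Z: "a \<in> Z" "i \<in> Z" "n \<in> Z" "l \<in> Z" for a i n l
    proof
      fix w
      \<comment> \<open>Fixing \<open>j = D a i n\<close> and \<open>b = D i a l\<close> first and
        solving for \<open>k\<close> and \<open>m\<close> reaches all \<open>a\<close>,
        \<open>i\<close>, \<open>n\<close>, \<open>l\<close>. Injectivity of \<open>D a i\<close>
        identifies the \<open>n'\<close> from \<open>ybe\<close> with \<open>n\<close>.\<close>
      have jb: "D a i n \<in> Z" "D i a l \<in> Z" using DZ in_Z by auto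
      obtain k where k: "k \<in> Z" "S (D a i n) k = a" using S_ex jb in_Z by blast
      obtain m where m: "m \<in> Z" "S (D i a l) m = i" using S_ex jb in_Z by blast
      obtain n' where n': "n' \<in> Z" "D a i n' = D a i n"
        "\<forall>w\<in>Z. S (D a i n) (S l w) = S (D i a l) (S n' w)"
        using ybe[OF in_Z(2) jb(1) k(1) in_Z(4) m(1) k(2)[symmetric] refl m(2)] in_Z by blast
      then have "n' = n" using D_cancel in_Z by blast
      show "(S (D a i n) \<circ> S l) w = (S (D i a l) \<circ> S n) w"
      proof (cases "w \<in> Z")
        case True then show ?thesis using n' \<open>n' = n\<close> by simp
      next
        case False then show ?thesis by (simp add: S_def)
      qed
    qed
    show "D (S b m) (S j q) (D k q l) = D (S j k) (S j q) (D m q' l)"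
      if in_Z: "j \<in> Z" "b \<in> Z" "m \<in> Z" "k \<in> Z" "q \<in> Z" "q' \<in> Z" "l \<in> Z" and eq: "S b q' = S j q"
      for j b m k q q' l
    proof -
      have ia: "S b m \<in> Z" "S j k \<in> Z" using SZ in_Z by auto
      \<comment> \<open>\<open>l1\<close> realises the prescribed \<open>b\<close>, and
        \<open>w\<close> is chosen so that the inner argument \<open>S l1 w\<close> is
        \<open>q\<close>; cancelling \<open>S b\<close> then gives
        \<open>S n w = q'\<close>.\<close>
      obtain l1 where l1: "l1 \<in> Z" "D (S b m) (S j k) l1 = b" using D_ex ia in_Z by blast
      obtain w where w: "w \<in> Z" "S l1 w = q" using S_ex l1 in_Z by blast
      obtain n where n: "n \<in> Z" "S j (S l1 w) = S b (S n w)"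
        "D (S b m) (S j (S l1 w)) (D k (S l1 w) l) = D (S j k) (S j (S l1 w)) (D m (S n w) l)"
        using ybe[OF ia(1) in_Z(1,4) l1(1) in_Z(3) refl l1(2)[symmetric] refl] w in_Z by blast
      then have "S n w = q'" using S_cancel[of b "S n w" q'] eq w in_Z by simp
      then show ?thesis using n w by simp
    qed
  qed
qed

section \<open>Passage to integer coordinates\<close>

text \<open>With integer indices, equality of labelled points becomes divisibility by
  \<open>p\<close>, so the structural identities turn into ring computations.\<close>

lemma periodic_int_enumeration:
  fixes p :: int and C :: "nat \<Rightarrow> 'a"
  assumes p: "p > 0" and bij: "bij_betw C {..<nat p} Z" and per: "\<And>n. C (n mod nat p) = C n"
  obtains C' :: "int \<Rightarrow> 'a" where "\<And>n. C' (int n) = C n" "\<And>x. C' x \<in> Z"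
    "\<And>x y. C' x = C' y \<longleftrightarrow> p dvd x - y" "\<And>c. c \<in> Z \<Longrightarrow> \<exists>x\<in>Zp p. C' x = c"
proof (rule that[of "\<lambda>x. C (nat (x mod p))"])
  show "C (nat (int n mod p)) = C n" for n
    using per[of n] p by (simp add: nat_mod_distrib)
  have lt: "nat (x mod p) \<in> {..<nat p}" for x using p by simp
  show "C (nat (x mod p)) \<in> Z" for x using bij lt by (metis bij_betwE)
  show "C (nat (x mod p)) = C (nat (y mod p)) \<longleftrightarrow> p dvd x - y" for x y
  proof -
    have "C (nat (x mod p)) = C (nat (y mod p)) \<longleftrightarrow> nat (x mod p) = nat (y mod p)"
      using bij lt by (auto simp: bij_betw_def inj_on_eq_iff)
    also have "\<dots> \<longleftrightarrow> x mod p = y mod p" using p by (simp add: nat_eq_iff)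
    finally show ?thesis by (simp add: mod_eq_dvd_iff)
  qed
  show "\<exists>x\<in>Zp p. C (nat (x mod p)) = c" if c: "c \<in> Z" for c
  proof -
    obtain n where "n < nat p" "C n = c" using bij c by (auto simp: bij_betw_def)
    then show ?thesis by (intro bexI[of _ "int n"]) (auto simp: Zp_def)
  qed
qed

lemma solution_affine_form:
  fixes p :: int
  assumes p: "prime p" and sol: "is_solution (XX p) r" and irr: "irretractable (XX p) r"
    and sj: "\<And>j k. j \<in> Zp p \<Longrightarrow> k \<in> Zp p \<Longrightarrow> sj j k \<in> Zp p"
    and d: "\<And>i k l. i \<in> Zp p \<Longrightarrow> k \<in> Zp p \<Longrightarrow> l \<in> Zp p \<Longrightarrow> d i k l \<in> Zp p"
    and form: "\<And>i j k l. \<lbrakk>i \<in> Zp p; j \<in> Zp p; k \<in> Zp p; l \<in> Zp p\<rbrakk> \<Longrightarrow>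
      sig r (i, j) (k, l) = (sj j k, d i (sj j k) l)"
  obtains t J C E where "t \<in> Zp p" "t \<noteq> 0"
    "\<And>x. J x \<in> Zp p" "\<And>x y. p dvd x - y \<Longrightarrow> J x = J y"
    "\<And>x. J (- x) = J x" "\<And>x. p dvd J (t * x) - (t * J x - (t - 1) * J 0)"
    "\<And>x. C x \<in> Zp p" "\<And>x y. C x = C y \<longleftrightarrow> p dvd x - y" "\<And>c. c \<in> Zp p \<Longrightarrow> \<exists>x\<in>Zp p. C x = c"
    "\<And>x. E x \<in> Zp p" "\<And>x y. E x = E y \<longleftrightarrow> p dvd x - y" "\<And>c. c \<in> Zp p \<Longrightarrow> \<exists>x\<in>Zp p. E x = c"
    "\<And>i j k l. sig r (C i, E j) (C k, E l) = (C (t * k + j), E (t * (l - J (t * k + j - i))))"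
proof -
  let ?Z = "Zp p"
  have p0: "p > 0" using p prime_gt_0_int by blast
  have p1: "p > 1" using p prime_gt_1_int by blast
  have card: "card ?Z = nat p" by (simp add: Zp_def)
  have fin: "finite ?Z" by (simp add: Zp_def)
  have pn: "prime (card ?Z)" using p by (simp add: card)
  obtain S D where S: "\<And>j. j \<in> ?Z \<Longrightarrow> S j permutes ?Z"
    and D: "\<And>i k. i \<in> ?Z \<Longrightarrow> k \<in> ?Z \<Longrightarrow> D i k permutes ?Z"
    and sigSD: "\<And>i j k l. \<lbrakk>i \<in> ?Z; j \<in> ?Z; k \<in> ?Z; l \<in> ?Z\<rbrakk> \<Longrightarrow> sig r (i, j) (k, l) = (S j k, D i (S j k) l)"
    and S_inj: "inj_on S ?Z"
    and A: "\<And>a i n l. \<lbrakk>a \<in> ?Z; i \<in> ?Z; n \<in> ?Z; l \<in> ?Z\<rbrakk> \<Longrightarrow> S (D a i n) \<circ> S l = S (D i a l) \<circ> S n"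
    and B: "\<And>j b m k q q' l. \<lbrakk>j \<in> ?Z; b \<in> ?Z; m \<in> ?Z; k \<in> ?Z; q \<in> ?Z; q' \<in> ?Z; l \<in> ?Z; S b q' = S j q\<rbrakk> \<Longrightarrow>
       D (S b m) (S j q) (D k q l) = D (S j k) (S j q) (D m q' l)"
  proof (rule fibred_solution[OF sol[unfolded XX_def] fin irr[unfolded XX_def], of sj d], goal_cases)
    case (4 S D)
    show ?case by (rule that[of S D]) (fact 4)+
  qed (rule sj d form; assumption)+
  have z: "0 \<in> ?Z" "1 \<in> ?Z" using p1 by (auto simp: Zp_def)
  \<comment> \<open>If all \<open>D a i\<close> agreed, the distinct points \<open>(0, 0)\<close>
    and \<open>(1, 0)\<close> would act identically, against irretractability.\<close>
  have "\<exists>a\<in>?Z. \<exists>i\<in>?Z. D a i \<noteq> D 0 0"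
  proof (rule ccontr)
    assume "\<not> ?thesis"
    then have const: "D a i = D 0 0" if "a \<in> ?Z" "i \<in> ?Z" for a i using that by blast
    have "sig r (0, 0) (k, l) = sig r (1, 0) (k, l)" if "k \<in> ?Z" "l \<in> ?Z" for k l
    proof -
      have "S 0 k \<in> ?Z" using permutes_in_image[OF S[OF z(1)]] that by blast
      then show ?thesis using z that const[of 1 "S 0 k"] const[of 0 "S 0 k"] by (simp add: sigSD)
    qed
    moreover have "(0, 0) \<in> XX p" "(1, 0) \<in> XX p" using z by (auto simp: XX_def)
    then obtain y where "y \<in> XX p" "sig r (0, 0) y \<noteq> sig r (1, 0) y"
      using irr[unfolded irretractable_def, rule_format, of "(0, 0)" "(1, 0)"] by auto
    ultimately show False by (auto simp: XX_def)
  qed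
  then obtain a i where ai: "a \<in> ?Z" "i \<in> ?Z" "D a i \<noteq> D 0 0" by blast
  obtain Cn En tn where C_bij: "bij_betw Cn {..<card ?Z} ?Z" and E_bij: "bij_betw En {..<card ?Z} ?Z"
    and C_per: "\<And>n. Cn (n mod card ?Z) = Cn n" and E_per: "\<And>n. En (n mod card ?Z) = En n"
    and tn: "\<not> card ?Z dvd tn" and SEC: "\<And>m n. S (En m) (Cn n) = Cn (tn * n + m)"
  proof (rule affine_coordinates[of ?Z S D 0 a i], goal_cases)
    case (10 C E t)
    show ?case by (rule that[of C E t]) (fact 10)+
  qed (rule pn S D S_inj A z ai; assumption)+
  obtain C where C_nat: "\<And>n. C (int n) = Cn n" and C_in: "\<And>x. C x \<in> ?Z"
    and C_eq: "\<And>x y. C x = C y \<longleftrightarrow> p dvd x - y" and C_ex: "\<And>c. c \<in> ?Z \<Longrightarrow> \<exists>x\<in>?Z. C x = c"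
  proof (rule periodic_int_enumeration[OF p0 C_bij[unfolded card]], goal_cases)
    case (2 C)
    show ?case by (rule that[of C]) (fact 2)+
  qed (rule C_per[unfolded card]; assumption)+
  obtain E where E_nat: "\<And>n. E (int n) = En n" and E_in: "\<And>x. E x \<in> ?Z"
    and E_eq: "\<And>x y. E x = E y \<longleftrightarrow> p dvd x - y" and E_ex: "\<And>c. c \<in> ?Z \<Longrightarrow> \<exists>x\<in>?Z. E x = c"
  proof (rule periodic_int_enumeration[OF p0 E_bij[unfolded card]], goal_cases)
    case (2 E)
    show ?case by (rule that[of E]) (fact 2)+
  qed (rule E_per[unfolded card]; assumption)+
  define t where "t = int tn mod p"
  have t_tn: "p dvd t - int tn" unfolding t_def by (metis mod_eq_dvd_iff mod_mod_trivial)
  have t0: "t \<noteq> 0"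
  proof
    assume "t = 0"
    then have "p dvd int tn" by (simp add: t_def dvd_eq_mod_eq_0)
    then have "nat p dvd tn" using p0 by (metis int_dvd_int_iff int_nat_eq less_imp_le)
    then show False using tn card by simp
  qed
  have t_in: "t \<in> ?Z" using p0 by (simp add: t_def Zp_def)
  have t_ndvd: "\<not> p dvd t" using t_in t0 by (auto simp: Zp_def dest: zdvd_imp_le)
  have SC: "S (E m) (C n) = C (t * n + m)" for m n
  proof -
    define m' where "m' = nat (m mod p)"
    define n' where "n' = nat (n mod p)"
    have int_mn: "int m' = m mod p" "int n' = n mod p" using p0 by (auto simp: m'_def n'_def)
    then have mn: "p dvd int m' - m" "p dvd int n' - n"
      by (metis mod_eq_dvd_iff mod_mod_trivial)+
    have "E m = En m'" "C n = Cn n'" using mn E_eq C_eq E_nat C_nat by (metis dvd_diff_commute)+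
    then have "S (E m) (C n) = C (int (tn * n' + m'))" using SEC C_nat by metis
    moreover have "p dvd (int tn * int n' + int m') - (t * n + m)" using mn t_tn by algebra
    ultimately show ?thesis using C_eq by simp
  qed
  \<comment> \<open>\<open>d'\<close> is \<open>D\<close> read in the coordinates \<open>C\<close>
    and \<open>E\<close>. The choice of representative is arbitrary, since only its class modulo
    \<open>p\<close> enters.\<close>
  define d' where "d' i k l = (SOME x. E x = D (C i) (C k) (E l))" for i k l
  have E_d': "E (d' i k l) = D (C i) (C k) (E l)" for i k l
  proof -
    have "D (C i) (C k) (E l) \<in> ?Z" using permutes_in_image[OF D] C_in E_in by simp
    then show ?thesis unfolding d'_def using E_ex by (metis (mono_tags, lifting) someI)
  qed
  obtain J where J: "\<And>x. J x \<in> ?Z" "\<And>x y. p dvd x - y \<Longrightarrow> J x = J y"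
    "\<And>x. J (- x) = J x" "\<And>x. p dvd J (t * x) - (t * J x - (t - 1) * J 0)"
    and d'_J: "\<And>i k l. p dvd d' i k l - t * (l - J (k - i))"
  proof (rule affine_structure[OF p t_ndvd, of d'])
    show "p dvd d' i k l - d' i' k' l'" if "p dvd i - i'" "p dvd k - k'" "p dvd l - l'" for i i' k k' l l'
    proof -
      have "C i = C i'" "C k = C k'" "E l = E l'" using that C_eq E_eq by blast+
      then have "E (d' i k l) = E (d' i' k' l')" by (simp add: E_d')
      then show ?thesis by (simp add: E_eq)
    qed
    show "p dvd (t * l + d' a i n) - (t * n + d' i a l)" for a i n l
    proof -
      have "S (E (d' a i n)) (S (E l) (C 0)) = S (E (d' i a l)) (S (E n) (C 0))"
        using fun_cong[OF A[OF C_in C_in E_in E_in, of a i n l], of "C 0"] by (simp add: E_d')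
      then show ?thesis by (simp add: SC C_eq)
    qed
    show "p dvd d' (t * m + b) (t * q + j) (d' k q l) - d' (t * k + j) (t * q + j) (d' m q' l)"
      if "t * q' + b = t * q + j" for j b m k q q' l
      using B[of "E j" "E b" "C m" "C k" "C q" "C q'" "E l"] that C_in E_in
      unfolding E_eq[symmetric] E_d' SC by simp
  qed blast
  show thesis
  proof (rule that[OF t_in t0 J C_in C_eq C_ex E_in E_eq E_ex])
    show "sig r (C i, E j) (C k, E l) = (C (t * k + j), E (t * (l - J (t * k + j - i))))" for i j k l
    proof -
      have "sig r (C i, E j) (C k, E l) = (C (t * k + j), E (d' i (t * k + j) l))"
        using sigSD C_in E_in by (simp add: SC E_d')
      moreover have "E (d' i (t * k + j) l) = E (t * (l - J (t * k + j - i)))"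
        unfolding E_eq by (rule d'_J)
      ultimately show ?thesis by simp
    qed
  qed
qed

text \<open>\<open>J_t\<close> says that \<open>x \<mapsto> J x - J 0\<close> commutes with
  multiplication by \<open>t\<close>, hence with every power of \<open>t\<close>. Comparing the
  powers \<open>t ^ n\<close> at \<open>x\<close> and \<open>t ^ m\<close> at \<open>u * x\<close>
  and dividing by \<open>t ^ m\<close> covers quotients, that is, negative exponents.\<close>

lemma affine_power_relation:
  fixes p t :: int and J :: "int \<Rightarrow> int"
  assumes p: "prime p" and t: "\<not> p dvd t" and J_per: "\<And>x y. p dvd x - y \<Longrightarrow> J x = J y"
    and J_t: "\<And>x. p dvd J (t * x) - (t * J x - (t - 1) * J 0)"
    and u: "p dvd u * t ^ m - t ^ n"
  shows "p dvd J (u * x) - (u * J x - (u - 1) * J 0)"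
proof -
  have pow: "p dvd J (t ^ n * x) - (t ^ n * J x - (t ^ n - 1) * J 0)" for n x
  proof (induction n)
    case (Suc n)
    have step: "p dvd a' - (t * v * J x - (t * v - 1) * J 0)"
      if "p dvd a' - (t * a - (t - 1) * J 0)" "p dvd a - (v * J x - (v - 1) * J 0)" for a a' v
      using that by algebra
    have "p dvd J (t ^ Suc n * x) - (t * J (t ^ n * x) - (t - 1) * J 0)"
      using J_t[of "t ^ n * x"] by (simp add: mult.assoc)
    from step[OF this Suc] show ?case by simp
  qed simp
  have "\<not> p dvd t ^ m" using p t prime_dvd_power by blast
  then obtain v' where v': "p dvd t ^ m * v' - 1" using prime_int_inverse_mod[OF p] by blast
  have "p dvd t ^ m * (u * x) - t ^ n * x"
  proof -
    have "p dvd (u * t ^ m - t ^ n) * x" using u by simp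
    then show ?thesis by (simp add: algebra_simps)
  qed
  then have "J (t ^ m * (u * x)) = J (t ^ n * x)" by (rule J_per)
  then have c: "p dvd J (t ^ n * x) - (t ^ m * J (u * x) - (t ^ m - 1) * J 0)"
    using pow[of m "u * x"] by simp
  have "p dvd b - (u * J x - (u - 1) * J 0)"
    if "p dvd a - (v * b - (v - 1) * J 0)" "p dvd a - (w * J x - (w - 1) * J 0)"
      "p dvd u * v - w" "p dvd v * v' - 1" for a b v w
    using that by algebra
  from this[OF c pow u v'] show ?thesis .
qed

section \<open>The isomorphism with \<open>rprime\<close>, and simplicity\<close>

theorem mainTheorem12:
  fixes p :: int
    and r :: "(int \<times> int) \<times> (int \<times> int) \<Rightarrow> (int \<times> int) \<times> (int \<times> int)"
    and T :: "'b itself"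
  assumes "prime p"
    and "is_solution (XX p) r"
    and "indecomposable (XX p) r"
    and "irretractable (XX p) r"
    and "\<exists>(sj :: int \<Rightarrow> int \<Rightarrow> int) (d :: int \<Rightarrow> int \<Rightarrow> int \<Rightarrow> int).
           (\<forall>j\<in>Zp p. sj j ` Zp p \<subseteq> Zp p) \<and>
           (\<forall>i\<in>Zp p. \<forall>k\<in>Zp p. d i k ` Zp p \<subseteq> Zp p) \<and>
           (\<forall>i\<in>Zp p. \<forall>j\<in>Zp p. \<forall>k\<in>Zp p. \<forall>l\<in>Zp p.
              r ((i, j), (k, l)) =
                ((sj j k, d i (sj j k) l),
                 inv_into (XX p) (sig r (sj j k, d i (sj j k) l)) (i, j)))"
  shows "\<exists>t\<in>Zp p. t \<noteq> 0 \<and>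
          (\<exists>jj :: int \<Rightarrow> int. jj ` Zp p \<subseteq> Zp p \<and>
             (\<forall>i\<in>Zp p. jj i = jj ((- i) mod p)) \<and>
             (\<forall>i\<in>Zp p. \<forall>s :: int. \<forall>u\<in>Zp p.
                (u * t ^ nat (- s)) mod p = (t ^ nat s) mod p \<longrightarrow>
                jj ((u * i) mod p) = (u * jj i - (u - 1) * jj 0) mod p) \<and>
             (\<exists>i\<in>Zp p. \<exists>k\<in>Zp p. i \<noteq> k \<and> jj i \<noteq> jj k) \<and>
             is_solution (XX p) (rprime p t jj) \<and>
             (\<exists>f. is_iso (XX p) r (XX p) (rprime p t jj) f)) \<and>
         simple_sol T (XX p) r"
proof -
  note p = assms(1) and sol = assms(2) and irr = assms(4)
  have p1: "p > 1" using p prime_gt_1_int by blast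
  have mod_dvd: "p dvd x mod p - x" for x by (metis mod_eq_dvd_iff mod_mod_trivial)
  have mod_Zp: "x mod p \<in> Zp p" for x using p1 by (simp add: Zp_def)
  have Zp_eqI: "x = y" if "p dvd x - y" "x \<in> Zp p" "y \<in> Zp p" for x y
    using that unfolding Zp_def by (metis atLeastLessThan_iff mod_eq_dvd_iff mod_pos_pos_trivial)
  obtain sj d where sj: "\<forall>j\<in>Zp p. sj j ` Zp p \<subseteq> Zp p"
    and d: "\<forall>i\<in>Zp p. \<forall>k\<in>Zp p. d i k ` Zp p \<subseteq> Zp p"
    and form: "\<forall>i\<in>Zp p. \<forall>j\<in>Zp p. \<forall>k\<in>Zp p. \<forall>l\<in>Zp p.
              r ((i, j), (k, l)) = ((sj j k, d i (sj j k) l),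
                 inv_into (XX p) (sig r (sj j k, d i (sj j k) l)) (i, j))"
    using assms(5) by (elim exE conjE) (rule that; assumption)
  have sj': "sj j k \<in> Zp p" if "j \<in> Zp p" "k \<in> Zp p" for j k using sj that by blast
  have d': "d i k l \<in> Zp p" if "i \<in> Zp p" "k \<in> Zp p" "l \<in> Zp p" for i k l using d that by blast
  have form': "sig r (i, j) (k, l) = (sj j k, d i (sj j k) l)"
    if "i \<in> Zp p" "j \<in> Zp p" "k \<in> Zp p" "l \<in> Zp p" for i j k l
    using form that by (simp add: sig_def)
  obtain t J C E where t: "t \<in> Zp p" "t \<noteq> 0"
    and J_in: "\<And>x. J x \<in> Zp p" and J_per: "\<And>x y. p dvd x - y \<Longrightarrow> J x = J y"
    and J_even: "\<And>x. J (- x) = J x" and J_t: "\<And>x. p dvd J (t * x) - (t * J x - (t - 1) * J 0)"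
    and C_in: "\<And>x. C x \<in> Zp p" and C_eq: "\<And>x y. C x = C y \<longleftrightarrow> p dvd x - y"
    and C_ex: "\<And>c. c \<in> Zp p \<Longrightarrow> \<exists>x\<in>Zp p. C x = c"
    and E_in: "\<And>x. E x \<in> Zp p" and E_eq: "\<And>x y. E x = E y \<longleftrightarrow> p dvd x - y"
    and E_ex: "\<And>c. c \<in> Zp p \<Longrightarrow> \<exists>x\<in>Zp p. E x = c"
    and sigCE: "\<And>i j k l. sig r (C i, E j) (C k, E l) = (C (t * k + j), E (t * (l - J (t * k + j - i))))"
  proof (rule solution_affine_form[OF p sol irr, of sj d], goal_cases)
    case (4 t J C E)
    show ?case by (rule that[of t J C E]) (fact 4)+
  qed (rule sj' d' form'; assumption)+
  have t_ndvd: "\<not> p dvd t" using t by (auto simp: Zp_def dest: zdvd_imp_le)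
  have zero_one: "0 \<in> Zp p" "1 \<in> Zp p" using p1 by (auto simp: Zp_def)

  \<comment> \<open>For constant \<open>J\<close> the action of \<open>(C i, E j)\<close> would not
    depend on \<open>i\<close>.\<close>
  have "\<exists>x y. J x \<noteq> J y"
  proof (rule ccontr)
    assume "\<not> ?thesis"
    then have "J x = J y" for x y by blast
    then have same: "sig r (C 0, E 0) (C k, E l) = sig r (C 1, E 0) (C k, E l)" for k l
      unfolding sigCE by metis
    have "\<not> p dvd 1" using p not_prime_unit by blast
    then have "C 0 \<noteq> C 1" by (simp add: C_eq)
    then obtain y where "y \<in> XX p" "sig r (C 0, E 0) y \<noteq> sig r (C 1, E 0) y"
      using irr C_in E_in unfolding irretractable_def XX_def by blast
    moreover obtain k l where "y = (C k, E l)"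
      using \<open>y \<in> XX p\<close> C_ex E_ex unfolding XX_def by blast
    ultimately show False using same by blast
  qed
  then obtain x1 x2 where J_ne: "J x1 \<noteq> J x2" by blast

  \<comment> \<open>\<open>g\<close> sends coordinates to points; the required isomorphism is its
    inverse.\<close>
  define g where "g = (\<lambda>(i, j). (C i, E j))"
  have g: "bij_betw g (XX p) (XX p)"
    unfolding bij_betw_def
  proof
    show "inj_on g (XX p)"
      by (rule inj_onI) (auto simp: g_def XX_def C_eq E_eq intro: Zp_eqI)
    show "g ` XX p = XX p"
    proof
      show "g ` XX p \<subseteq> XX p" using C_in E_in by (auto simp: g_def XX_def)
      show "XX p \<subseteq> g ` XX p"
      proof
        fix y assume "y \<in> XX p"
        then obtain k l where "k \<in> Zp p" "l \<in> Zp p" "y = (C k, E l)"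
          using C_ex E_ex unfolding XX_def by blast
        then show "y \<in> g ` XX p" by (auto simp: g_def XX_def image_iff)
      qed
    qed
  qed
  have g_inj: "x = y" if "g x = g y" "x \<in> XX p" "y \<in> XX p" for x y
    using g that by (auto simp: bij_betw_def dest: inj_onD)
  have g_in: "g x \<in> XX p" if "x \<in> XX p" for x using g that by (metis bij_betwE)
  have sigp_in: "sigp p t J x y \<in> XX p" for x y
    using mod_Zp by (simp add: sigp_def XX_def split_beta)
  have sig_g: "sig r (g x) (g y) = g (sigp p t J x y)" for x y
  proof -
    obtain i j k l where xy: "x = (i, j)" "y = (k, l)" by fastforce
    have "J ((t * k + j - i) mod p) = J (t * k + j - i)" by (rule J_per[OF mod_dvd])
    moreover have "C (z mod p) = C z" "E (z mod p) = E z" for z by (simp_all add: C_eq E_eq mod_dvd)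
    ultimately show ?thesis by (simp add: xy g_def sigp_def sigCE)
  qed
  have sig_bij: "bij_betw (sig r x) (XX p) (XX p)" if "x \<in> XX p" for x
    using sol that unfolding is_solution_def by blast
  have sigp_inj: "inj_on (sigp p t J x) (XX p)" if x: "x \<in> XX p" for x
  proof (rule inj_onI)
    fix y z assume yz: "y \<in> XX p" "z \<in> XX p" "sigp p t J x y = sigp p t J x z"
    then have "sig r (g x) (g y) = sig r (g x) (g z)" by (simp add: sig_g)
    then have "g y = g z"
      using bij_betw_imp_inj_on[OF sig_bij[OF g_in[OF x]]] g_in yz by (meson inj_onD)
    then show "y = z" using g_inj yz by blast
  qed
  have rprime_g: "r (g x, g y) = (g (fst (rprime p t J (x, y))), g (snd (rprime p t J (x, y))))"
    if x: "x \<in> XX p" and y: "y \<in> XX p" for x y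
  proof -
    have "snd (r (g x, g y)) \<in> g ` XX p"
      using solution_closed(2)[OF sol g_in[OF x] g_in[OF y]] g by (simp add: bij_betw_def)
    then obtain v where v: "v \<in> XX p" "snd (r (g x, g y)) = g v" by blast
    \<comment> \<open>The second component of \<open>r\<close> is determined by \<sigma>, being the
      preimage of \<open>g x\<close> under the map of the first component. Pulled back along
      \<open>g\<close>, this is the defining inverse in \<open>rprime\<close>.\<close>
    have "g (sigp p t J (sigp p t J x y) v) = g x"
      using solution_sig_gam[OF sol g_in[OF x] g_in[OF y]] v by (simp add: sig_g)
    then have "sigp p t J (sigp p t J x y) v = x" using g_inj sigp_in x by blast
    then have "inv_into (XX p) (sigp p t J (sigp p t J x y)) x = v"
      using inv_into_f_eq[OF sigp_inj[OF sigp_in] v(1)] by blast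
    moreover have "fst (r (g x, g y)) = g (sigp p t J x y)" using sig_g[of x y] by (simp add: sig_def)
    ultimately show ?thesis using v by (intro prod_eqI) (simp_all add: rprime_def)
  qed

  define f where "f = inv_into (XX p) g"
  have f: "bij_betw f (XX p) (XX p)" unfolding f_def by (rule bij_betw_inv_into[OF g])
  have fg: "f (g x) = x" if "x \<in> XX p" for x
    unfolding f_def using bij_betw_inv_into_left[OF g that] .
  have gf: "g (f x) = x" if "x \<in> XX p" for x
    unfolding f_def using bij_betw_inv_into_right[OF g that] .
  have f_in: "f x \<in> XX p" if "x \<in> XX p" for x using f that by (metis bij_betwE)
  have rprime_f: "rprime p t J (f x, f y) = (f (fst (r (x, y))), f (snd (r (x, y))))"
    if x: "x \<in> XX p" and y: "y \<in> XX p" for x y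
  proof -
    have eq: "r (x, y) = (g (fst (rprime p t J (f x, f y))), g (snd (rprime p t J (f x, f y))))"
      using rprime_g[OF f_in[OF x] f_in[OF y]] gf x y by simp
    have "fst (rprime p t J (f x, f y)) \<in> XX p" using sigp_in by (simp add: rprime_def)
    moreover have "snd (rprime p t J (f x, f y)) \<in> XX p"
    proof -
      \<comment> \<open>Surjectivity ensures that the \<open>inv_into\<close> value lies in
        \<open>XX p\<close>, where \<open>f\<close> undoes \<open>g\<close>.\<close>
      have "sigp p t J z ` XX p = XX p" if "z \<in> XX p" for z
      proof (rule endo_inj_surj)
        show "finite (XX p)" by (simp add: XX_def Zp_def)
      qed (use sigp_in sigp_inj[OF that] in blast)+
      then have "f x \<in> sigp p t J (sigp p t J (f x) (f y)) ` XX p" using sigp_in f_in x by blast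
      then show ?thesis by (simp add: rprime_def inv_into_into)
    qed
    ultimately show ?thesis using fg by (simp add: eq)
  qed
  have rprime_sol: "is_solution (XX p) (rprime p t J)"
    by (rule solution_transfer[OF sol f rprime_f])
  have iso: "is_iso (XX p) r (XX p) (rprime p t J) f"
    unfolding is_iso_def using f rprime_f by (simp add: sig_def)

  have simple: "simple_sol T (XX p) r"
    unfolding simple_sol_def
  proof (intro conjI allI impI)
    show "\<exists>x\<in>XX p. \<exists>y\<in>XX p. x \<noteq> y"
      using zero_one by (intro bexI[of _ "(0, 0)"] bexI[of _ "(1, 0)"]) (auto simp: XX_def)
    fix Y :: "'b set" and s h
    assume h: "is_solution Y s \<and> is_hom (XX p) r Y s h \<and> h ` XX p = Y"
    have h_sig: "h (sig r x y) = sig s (h x) (h y)" if "x \<in> XX p" "y \<in> XX p" for x y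
      using h that by (simp add: is_hom_def sig_def)
    have h_in: "h x \<in> Y" if "x \<in> XX p" for x using h that by blast
    have s_inj: "y = z" if "sig s x y = sig s x z" "x \<in> Y" "y \<in> Y" "z \<in> Y" for x y z
    proof -
      have "inj_on (sig s x) Y" using h that(2) by (simp add: is_solution_def bij_betw_def)
      then show ?thesis using that by (auto dest: inj_onD)
    qed
    have CE_in: "(C i, E j) \<in> XX p" for i j using C_in E_in by (simp add: XX_def)
    have CE_ex: "\<exists>i j. x = (C i, E j)" if "x \<in> XX p" for x
      using that C_ex E_ex unfolding XX_def by blast
    \<comment> \<open>\<open>F\<close> is the given homomorphism in coordinates; two points with
      equal image supply the identified pair, forcing a one-point image.\<close>
    define F where "F i j = h (C i, E j)" for i j
    have F_sig: "F (t * k + j) (t * (l - J (t * k + j - i))) = sig s (F i j) (F k l)" for i j k l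
      unfolding F_def using h_sig[OF CE_in CE_in] by (simp add: sigCE)
    have F_in: "F i j \<in> Y" for i j unfolding F_def by (rule h_in[OF CE_in])
    show "inj_on h (XX p) \<or> (\<exists>c. h ` XX p = {c})"
    proof (rule disjCI)
      assume not_const: "\<nexists>c. h ` XX p = {c}"
      show "inj_on h (XX p)"
      proof (rule inj_onI, rule ccontr)
        fix x y assume xy: "x \<in> XX p" "y \<in> XX p" "h x = h y" "x \<noteq> y"
        obtain i0 j0 i1 j1 where ij: "x = (C i0, E j0)" "y = (C i1, E j1)" using CE_ex xy by blast
        have "F a b = F a' b'" for a b a' b'
        proof (rule affine_nontrivial_kernel_total[of p t J x1 x2 F i0 j0 i1 j1])
          show "F i j = F i' j'" if "p dvd i - i'" "p dvd j - j'" for i i' j j'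
            using that C_eq[of i i'] E_eq[of j j'] by (simp add: F_def)
          show "F (t * k + j) (t * (l - J (t * k + j - i))) = F (t * k' + j') (t * (l' - J (t * k' + j' - i')))"
            if "F i j = F i' j'" "F k l = F k' l'" for i j k l i' j' k' l'
            by (simp only: F_sig that)
          show "F k l = F k' l'"
            if "F (t * k + j) (t * (l - J (t * k + j - i))) = F (t * k' + j) (t * (l' - J (t * k' + j - i)))"
            for i j k l k' l'
            using that unfolding F_sig by (rule s_inj) (rule F_in)+
          show "F i0 j0 = F i1 j1" using xy ij by (simp add: F_def)
          show "\<not> (p dvd i0 - i1 \<and> p dvd j0 - j1)" using xy ij by (simp add: C_eq E_eq)
        qed (fact p t_ndvd J_in J_ne J_even J_per)+
        then have "h z = h x" if "z \<in> XX p" for z using CE_ex[OF that] ij by (auto simp: F_def)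
        then have "h ` XX p \<subseteq> {h x}" by blast
        then have "h ` XX p = {h x}" using xy(1) by blast
        then show False using not_const by blast
      qed
    qed
  qed

  have jj_even: "J i = J ((- i) mod p)" for i
    using J_even[of i] J_per[OF mod_dvd, of "- i"] by simp
  \<comment> \<open>At least one of \<open>nat s\<close> and \<open>nat (- s)\<close> is 0, so the
    condition says that \<open>u\<close> is \<open>t\<close> to the integer power \<open>s\<close>
    modulo \<open>p\<close>.\<close>
  have jj_pow: "J ((u * i) mod p) = (u * J i - (u - 1) * J 0) mod p"
    if "(u * t ^ nat (- s)) mod p = (t ^ nat s) mod p" for i s u
  proof (rule Zp_eqI[OF _ J_in mod_Zp])
    have "p dvd u * t ^ nat (- s) - t ^ nat s" using that by (simp add: mod_eq_dvd_iff)
    from affine_power_relation[OF p t_ndvd J_per J_t this, of i]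
    have "p dvd J ((u * i) mod p) - (u * J i - (u - 1) * J 0)" by (simp only: J_per[OF mod_dvd])
    then show "p dvd J ((u * i) mod p) - (u * J i - (u - 1) * J 0) mod p"
      by (simp add: mod_eq_dvd_iff[symmetric])
  qed
  have "J (x1 mod p) \<noteq> J (x2 mod p)" using J_ne J_per[OF mod_dvd] by simp
  then have jj_ne: "\<exists>i\<in>Zp p. \<exists>k\<in>Zp p. i \<noteq> k \<and> J i \<noteq> J k" using mod_Zp by metis
  show ?thesis
  proof (rule bexI[OF _ t(1)], rule conjI[OF t(2)], rule conjI[OF exI[of _ J] simple], intro conjI)
    show "J ` Zp p \<subseteq> Zp p" using J_in by blast
    show "\<forall>i\<in>Zp p. J i = J ((- i) mod p)" using jj_even by blast
    show "\<forall>i\<in>Zp p. \<forall>s :: int. \<forall>u\<in>Zp p. (u * t ^ nat (- s)) mod p = (t ^ nat s) mod p \<longrightarrow>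
        J ((u * i) mod p) = (u * J i - (u - 1) * J 0) mod p"
      using jj_pow by blast
    show "\<exists>f. is_iso (XX p) r (XX p) (rprime p t J) f" using iso by blast
  qed (fact jj_ne rprime_sol)+
qed

end
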